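(* Let $n$ be a positive integer. The assignment $\mathcal{C}_A\mapsto C_A$ for $A\subset[n]$, sending each generator of the higher rank universal Bannai--Ito algebra $BI(n)$ to the corresponding intermediate Casimir element, defines an algebra homomorphism $$BI(n)\longrightarrow U(\mathfrak{osp}(1|2))^{\otimes n}.$$
   Context: Work over $\mathbb{C}$. $[X,Y]=XY-YX$ and $\{X,Y\}=XY+YX$. **The algebra.** $U=U(\mathfrak{osp}(1|2))$ denotes the unital associative algebra generated by $F^\pm,H,E^\pm$ and a grading involution $P$ with relations $[H,E^\pm]=\pm E^\pm$, $[E^+,E^-]=2H$, $[H,F^\pm]=\pm\frac12F^\pm$, $\{F^+,F^-\}=\frac12H$, $[E^\pm,F^\mp]=-F^\pm$, $\{F^\pm,F^\pm\}=\pm\frac12E^\pm$, $[P,E^\pm]=0$, $[P,H]=0$, $\{P,F^\pm\}=0$, $P^2=1$. Tensor powers of $U$ carry the ordinary (ungraded) componentwise product. The coproduct $\Delta:U\to U\otimes U$ is the (coassociative) algebra homomorphism with $\Delta(E^\pm)=E^\pm\otimes1+1\otimes E^\pm$, $\Delta(H)=H\otimes1+1\otimes H$, $\Delta(F^\pm)=F^\pm\otimes P+1\otimes F^\pm$, $\Delta(P)=P\otimes P$. Set $\Delta^{(0)}=\mathrm{id}$ and $\Delta^{(k)}=(\mathrm{id}\otimes\Delta^{(k-1)})\Delta$. The Casimir element is $C=8[F^+,F^-]P+P$, which is central in $U$. **Universal $R$-matrix.** $\mathcal{R}=\frac12(1\otimes1+P\otimes1+1\otimes P-P\otimes P)\in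 U\otimes U$, with $\mathcal R^{-1}=\mathcal R$. $\mathcal{R}_{i,j}$ denotes $\mathcal R$ placed in factors $i$ and $j$ of $U^{\otimes n}$. **Action of permutations.** Let $\sigma_{i,i+1}$ be the operator exchanging factors $i$ and $i+1$, i.e. $\sigma_{i,i+1}X\sigma_{i,i+1}^{-1}$ is $X$ with tensor factors $i$ and $i+1$ interchanged. Put $\check{\mathcal R}_i=\mathcal R_{i,i+1}\sigma_{i,i+1}$. Let $s_i\in\mathfrak S_n$ be the transposition $(i\ i{+}1)$, with permutations composed from right to left. For $s=s_{i_1}s_{i_2}\cdots s_{i_p}\in\mathfrak S_n$ and $X\in U^{\otimes n}$, $$\gamma_s(X)=\check{\mathcal R}_{i_1}\cdots\check{\mathcal R}_{i_p}\,X\,(\check{\mathcal R}_{i_1}\cdots\check{\mathcal R}_{i_p})^{-1};$$ this does not depend on the chosen decomposition of $s$. **Intermediate Casimir elements.** Let $[n]=\{1,\dots,n\}$. For $1\le k\le\ell\le n$ and $K=\{k,k+1,\dots,\ell\}$, put $C_K=1^{\otimes(k-1)}\otimes\Delta^{(\ell-k)}(C)\otimes1^{\otimes(n-\ell)}$. For an arbitrary nonempty $A\subset[n]$, put $C_A=\gamma_s(C_K)$, where $K\subset[n]$ is a set of consecutive integers with $|K|=|A|$ and $s\in\mathfrak S_n$ satisfies $s(K)=A$; the result does not depend on the choice of $K$ and $s$. Put $C_\emptyset=1$. **Bannai--Ito algebra.** $BI(n)$ is the unital associative algebra generated by $\mathcal C_A$, $A\subset[n]$, with $\mathcal C_\emptyset=1$,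 and defining relations, for all $A,B\subset[n]$, $$\{\mathcal C_A,\mathcal C_B\}=2\bigl(-\mathcal C_{(A\cup B)\setminus(A\cap B)}+\mathcal C_{A\setminus(A\cap B)}\,\mathcal C_{B\setminus(A\cap B)}+\mathcal C_{A\cap B}\,\mathcal C_{A\cup B}\bigr).$$ *)

theory Defs
  imports
    Complex_Main
    "HOL-Library.Poly_Mapping"
    "HOL-Combinatorics.Permutations"
    "HOL-Algebra.QuotRing"
    "HOL-Algebra.Module"
begin

section \<open>Complex vector spaces and algebras\<close>

class complex_vector = ab_group_add +
  fixes scaleC :: "complex \<Rightarrow> 'a \<Rightarrow> 'a"  (infixr \<open>*\<^sub>C\<close> 75)
  assumes scaleC_add_right: "c *\<^sub>C (x + y) = c *\<^sub>C x + c *\<^sub>C y"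
    and scaleC_add_left: "(c + d) *\<^sub>C x = c *\<^sub>C x + d *\<^sub>C x"
    and scaleC_scaleC: "c *\<^sub>C d *\<^sub>C x = (c * d) *\<^sub>C x"
    and scaleC_one: "1 *\<^sub>C x = x"

global_interpretation cvs: vector_space "scaleC :: complex \<Rightarrow> 'a \<Rightarrow> 'a::complex_vector"
  by unfold_locales (simp_all add: scaleC_add_right scaleC_add_left scaleC_scaleC scaleC_one)

class complex_algebra = complex_vector + ring +
  assumes mult_scaleC_left: "(c *\<^sub>C x) * y = c *\<^sub>C (x * y)"
    and mult_scaleC_right: "x * (c *\<^sub>C y) = c *\<^sub>C (x * y)"

class complex_algebra_1 = complex_algebra + monoid_mult

text \<open>
  For objects whose underlying set depends on a natural number, algebras are records
  \<^typ>\<open>(complex, 'a) module\<close>, as in HOL-Algebra.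
\<close>

definition alg_hom :: "(complex, 'a) module \<Rightarrow> (complex, 'b) module \<Rightarrow> ('a \<Rightarrow> 'b) set" where
  "alg_hom A B = {h \<in> ring_hom A B.
     \<forall>c. \<forall>x\<in>carrier A. h (c \<odot>\<^bsub>A\<^esub> x) = c \<odot>\<^bsub>B\<^esub> h x}"


section \<open>Free algebras and algebras given by generators and relations\<close>

text \<open>
  Lists form the free monoid, so \<^typ>\<open>'g list \<Rightarrow>\<^sub>0 complex\<close> with the convolution product
  of \<^theory>\<open>HOL-Library.Poly_Mapping\<close> is the free unital algebra on \<^typ>\<open>'g\<close>.
\<close>

instantiation list :: (type) monoid_add
begin
definition zero_list :: "'a list" where "zero_list = []"
definition plus_list :: "'a list \<Rightarrow> 'a list \<Rightarrow> 'a list" where "plus_list = (@)"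
instance by standard (simp_all add: zero_list_def plus_list_def)
end

instantiation complex :: complex_algebra_1
begin
definition scaleC_complex :: "complex \<Rightarrow> complex \<Rightarrow> complex" where "scaleC_complex = (*)"
instance by standard (simp_all add: scaleC_complex_def algebra_simps)
end

instantiation poly_mapping :: (type, complex_vector) complex_vector
begin
definition scaleC_poly_mapping :: "complex \<Rightarrow> ('a \<Rightarrow>\<^sub>0 'b) \<Rightarrow> ('a \<Rightarrow>\<^sub>0 'b)" where
  "scaleC_poly_mapping c f = Poly_Mapping.map ((*\<^sub>C) c) f"

lemma lookup_scaleC [simp]: "Poly_Mapping.lookup (c *\<^sub>C f) k = c *\<^sub>C Poly_Mapping.lookup f k"
  for f :: "'a \<Rightarrow>\<^sub>0 'b"
  by (auto simp: scaleC_poly_mapping_def Poly_Mapping.map.rep_eq when_def)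

instance
  by standard (rule poly_mapping_eqI, simp add: lookup_add scaleC_add_right scaleC_add_left
      scaleC_scaleC scaleC_one)+
end

lemma keys_scaleC: "Poly_Mapping.keys (c *\<^sub>C f) \<subseteq> Poly_Mapping.keys f"
  by (auto simp: in_keys_iff)

lemma scaleC_single: "c *\<^sub>C Poly_Mapping.single k d = Poly_Mapping.single k (c *\<^sub>C d)"
  by (rule poly_mapping_eqI) (auto simp: lookup_single when_def)

lemma scaleC_complex [simp]: "c *\<^sub>C d = c * d" for d :: complex
  by (simp add: scaleC_complex_def)

definition pm_extend :: "('k \<Rightarrow> 'b::complex_vector) \<Rightarrow> ('k \<Rightarrow>\<^sub>0 complex) \<Rightarrow> 'b" where
  "pm_extend g f = (\<Sum>k\<in>Poly_Mapping.keys f. Poly_Mapping.lookup f k *\<^sub>C g k)"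

lemma pm_extend_superset:
  assumes "finite S" "Poly_Mapping.keys f \<subseteq> S"
  shows "pm_extend g f = (\<Sum>k\<in>S. Poly_Mapping.lookup f k *\<^sub>C g k)"
  unfolding pm_extend_def
  by (rule sum.mono_neutral_left) (use assms in \<open>auto simp: in_keys_iff\<close>)

lemma pm_induct [case_names single sum]:
  fixes f :: "'k \<Rightarrow>\<^sub>0 'b::comm_monoid_add"
  assumes single: "\<And>k c. Q (Poly_Mapping.single k c)"
    and sum: "\<And>f g. Q f \<Longrightarrow> Q g \<Longrightarrow> Q (f + g)"
  shows "Q f"
proof -
  have "Q (\<Sum>k\<in>S. Poly_Mapping.single k (c k))" if "finite S" for S c
    using that
  proof induction
    case empty
    then show ?case using single[of undefined 0] by simp
  qed (use assms in auto)
  moreover have "f = (\<Sum>k\<in>Poly_Mapping.keys f. Poly_Mapping.single k (Poly_Mapping.lookup f k))"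
    by (rule poly_mapping_eqI)
      (auto simp: lookup_sum lookup_single when_def in_keys_iff if_distrib cong: if_cong)
  ultimately show ?thesis by (metis finite_keys)
qed

lemma pm_extend_add: "pm_extend g (f1 + f2) = pm_extend g f1 + pm_extend g f2"
proof -
  let ?S = "Poly_Mapping.keys f1 \<union> Poly_Mapping.keys f2"
  have "finite ?S" "Poly_Mapping.keys f1 \<subseteq> ?S" "Poly_Mapping.keys f2 \<subseteq> ?S" "Poly_Mapping.keys (f1 + f2) \<subseteq> ?S"
    using keys_add[of f1 f2] by auto
  then show ?thesis
    by (simp add: pm_extend_superset[of ?S] lookup_add scaleC_add_left sum.distrib)
qed

lemma pm_extend_scaleC: "pm_extend g (c *\<^sub>C f) = c *\<^sub>C pm_extend g f"
  by (simp add: pm_extend_superset[OF _ keys_scaleC] cvs.scale_sum_right)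
     (simp add: pm_extend_def cvs.scale_sum_right)

lemma pm_extend_zero [simp]: "pm_extend g 0 = 0"
  by (simp add: pm_extend_def)

lemma pm_extend_minus: "pm_extend g (f1 - f2) = pm_extend g f1 - pm_extend g f2"
  by (metis add_diff_cancel diff_add_cancel pm_extend_add)

lemma pm_extend_uminus: "pm_extend g (- f) = - pm_extend g f"
  by (metis diff_0 pm_extend_minus pm_extend_zero)

lemma pm_extend_single [simp]: "pm_extend g (Poly_Mapping.single k c) = c *\<^sub>C g k"
  by (simp add: pm_extend_def)

lemma pm_extend_fun_add: "pm_extend (\<lambda>k. g k + h k) f = pm_extend g f + pm_extend h f"
  by (simp add: pm_extend_def scaleC_add_right sum.distrib)

lemma pm_extend_fun_scaleC: "pm_extend (\<lambda>k. c *\<^sub>C g k) f = c *\<^sub>C pm_extend g f"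
  by (simp add: pm_extend_def cvs.scale_sum_right mult.commute scaleC_scaleC)

lemma pm_linear_induct [consumes 0, case_names single add scale]:
  fixes f :: "'k \<Rightarrow>\<^sub>0 complex"
  assumes "\<And>k. Q (Poly_Mapping.single k 1)"
    and "\<And>f g. Q f \<Longrightarrow> Q g \<Longrightarrow> Q (f + g)"
    and "\<And>c f. Q f \<Longrightarrow> Q (c *\<^sub>C f)"
  shows "Q f"
proof (induction f rule: pm_induct)
  case (single k v)
  then show ?case
    using assms(3)[OF assms(1), of v k] by (simp add: scaleC_single)
next
  case (sum f g)
  then show ?case using assms(2) by blast
qed

lemma pm_mult_extend:
  fixes f g :: "'k::monoid_add \<Rightarrow>\<^sub>0 complex"
  shows "f * g =
    pm_extend (\<lambda>v. pm_extend (\<lambda>w. Poly_Mapping.single (v + w) 1) g) f"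
proof (induction f rule: pm_induct)
  case (single k c)
  show ?case
    by (induction g rule: pm_induct)
      (simp_all add: mult_single scaleC_single distrib_left pm_extend_add scaleC_add_right)
next
  case (sum f g)
  then show ?case by (simp add: distrib_right pm_extend_add)
qed

instance poly_mapping :: (monoid_add, "{complex_algebra}") complex_algebra
proof
  fix c :: complex and x y :: "'a \<Rightarrow>\<^sub>0 'b"
  have l: "(c *\<^sub>C x) * y = c *\<^sub>C (x * y)"
  proof (induction x rule: pm_induct)
    case (single k v)
    show ?case
      by (induction y rule: pm_induct)
        (simp_all add: mult_single scaleC_single mult_scaleC_left distrib_left scaleC_add_right)
  next
    case (sum f g)
    then show ?case by (simp add: distrib_right scaleC_add_right)
  qed
  show "(c *\<^sub>C x) * y = c *\<^sub>C (x * y)" by (rule l)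
  show "x * (c *\<^sub>C y) = c *\<^sub>C (x * y)"
  proof (induction x rule: pm_induct)
    case (single k v)
    show ?case
      by (induction y rule: pm_induct)
        (simp_all add: mult_single scaleC_single mult_scaleC_right distrib_left scaleC_add_right)
  next
    case (sum f g)
    then show ?case by (simp add: distrib_right scaleC_add_right)
  qed
qed

definition free_algebra :: "'g set \<Rightarrow> (complex, 'g list \<Rightarrow>\<^sub>0 complex) module" where
  "free_algebra G = \<lparr>carrier = {f. Poly_Mapping.keys f \<subseteq> lists G}, mult = (*), one = 1, zero = 0, add = (+),
     smult = (*\<^sub>C)\<rparr>"

definition free_gen :: "'g \<Rightarrow> ('g list \<Rightarrow>\<^sub>0 complex)" where
  "free_gen g = Poly_Mapping.single [g] 1"

definition presented_class ::
  "'g set \<Rightarrow> ('g list \<Rightarrow>\<^sub>0 complex) set \<Rightarrow> ('g list \<Rightarrow>\<^sub>0 complex) \<Rightarrow> ('g list \<Rightarrow>\<^sub>0 complex) set" where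
  "presented_class G S f = Idl\<^bsub>free_algebra G\<^esub> S +>\<^bsub>free_algebra G\<^esub> f"

text \<open>
  The quotient of the free algebra on \<open>G\<close> by the two-sided ideal generated by \<open>S\<close>;
  an element \<open>f\<close> of \<open>S\<close> stands for the relation \<open>f = 0\<close>.
\<close>

definition presented_algebra ::
  "'g set \<Rightarrow> ('g list \<Rightarrow>\<^sub>0 complex) set \<Rightarrow> (complex, ('g list \<Rightarrow>\<^sub>0 complex) set) module" where
  "presented_algebra G S =
    (let Q = free_algebra G Quot Idl\<^bsub>free_algebra G\<^esub> S in
     \<lparr>carrier = carrier Q, mult = monoid.mult Q, one = one Q, zero = zero Q, add = add Q,
      smult = (\<lambda>c X. \<Union>f\<in>X. presented_class G S (c *\<^sub>C f))\<rparr>)"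

lemma ring_free_algebra: "ring (free_algebra G)"
proof (rule ringI)
  show "abelian_group (free_algebra G)"
  proof (rule abelian_groupI)
    fix x assume x: "x \<in> carrier (free_algebra G)"
    have "- x \<in> carrier (free_algebra G)"
      using x by (auto simp: free_algebra_def in_keys_iff)
    then show "\<exists>y\<in>carrier (free_algebra G). y \<oplus>\<^bsub>free_algebra G\<^esub> x = \<zero>\<^bsub>free_algebra G\<^esub>"
      by (rule bexI[rotated]) (simp add: free_algebra_def)
  qed (use keys_add in \<open>fastforce simp: free_algebra_def ac_simps\<close>)+
  show "Group.monoid (free_algebra G)"
    by (rule monoidI)
      (use keys_mult in \<open>fastforce simp: free_algebra_def mult.assoc zero_list_def plus_list_def\<close>)+
qed (simp_all add: free_algebra_def algebra_simps)

lemma free_algebra_scaleC_closed: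
  "f \<in> carrier (free_algebra G) \<Longrightarrow> c *\<^sub>C f \<in> carrier (free_algebra G)"
  using keys_scaleC by (fastforce simp: free_algebra_def)

lemma ideal_free_algebra:
  assumes "S \<subseteq> carrier (free_algebra G)"
  shows "ideal (Idl\<^bsub>free_algebra G\<^esub> S) (free_algebra G)"
  using assms ring.genideal_ideal ring_free_algebra by blast

lemma ideal_free_algebra_scaleC:
  assumes "ideal I (free_algebra G)" "f \<in> I"
  shows "c *\<^sub>C f \<in> I"
proof -
  interpret ideal I "free_algebra G" by fact
  have "c *\<^sub>C 1 \<in> carrier (free_algebra G)"
    by (rule free_algebra_scaleC_closed) (simp add: free_algebra_def zero_list_def)
  then have "(c *\<^sub>C 1) \<otimes>\<^bsub>free_algebra G\<^esub> f \<in> I"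
    using assms(2) by (rule I_l_closed[rotated])
  then show ?thesis by (simp add: free_algebra_def mult_scaleC_left)
qed

lemma presented_class_smult:
  assumes S: "S \<subseteq> carrier (free_algebra G)" and f: "f \<in> carrier (free_algebra G)"
  shows "c \<odot>\<^bsub>presented_algebra G S\<^esub> presented_class G S f = presented_class G S (c *\<^sub>C f)"
proof -
  let ?I = "Idl\<^bsub>free_algebra G\<^esub> S"
  interpret I: ideal ?I "free_algebra G" by (rule ideal_free_algebra[OF S])
  have *: "presented_class G S (c *\<^sub>C f') = presented_class G S (c *\<^sub>C f)"
    if f': "f' \<in> presented_class G S f" for f'
  proof -
    obtain h where h: "h \<in> ?I" "f' = h + f"
      using f' by (auto simp: presented_class_def a_r_coset_def r_coset_def free_algebra_def)
    have "c *\<^sub>C f' = c *\<^sub>C h \<oplus>\<^bsub>free_algebra G\<^esub> c *\<^sub>C f"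
      by (simp add: h free_algebra_def scaleC_add_right)
    moreover have "c *\<^sub>C h \<in> ?I"
      using I.ideal_axioms h(1) by (rule ideal_free_algebra_scaleC)
    ultimately have "c *\<^sub>C f' \<in> ?I +>\<^bsub>free_algebra G\<^esub> c *\<^sub>C f"
      by (auto simp: a_r_coset_def r_coset_def)
    then show ?thesis
      unfolding presented_class_def
      using I.a_repr_independence'[OF _ free_algebra_scaleC_closed[OF f]] by blast
  qed
  have "f \<in> presented_class G S f"
    unfolding presented_class_def using f by (rule I.a_rcos_self)
  then have ne: "presented_class G S f \<noteq> {}" by blast
  have "(\<Union>f'\<in>presented_class G S f. presented_class G S (c *\<^sub>C f')) =
      (\<Union>f'\<in>presented_class G S f. presented_class G S (c *\<^sub>C f))"
    by (rule SUP_cong[OF refl *])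
  also have "\<dots> = presented_class G S (c *\<^sub>C f)"
    using ne by (rule SUP_const)
  finally show ?thesis
    by (simp add: presented_algebra_def Let_def)
qed

lemma carrier_presented:
  "carrier (presented_algebra G S) = presented_class G S ` carrier (free_algebra G)"
  by (auto simp: presented_algebra_def Let_def FactRing_def A_RCOSETS_def RCOSETS_def
      presented_class_def a_r_coset_def)

lemma ring_presented:
  assumes "S \<subseteq> carrier (free_algebra G)"
  shows "ring (presented_algebra G S)"
proof -
  let ?Q = "free_algebra G Quot Idl\<^bsub>free_algebra G\<^esub> S" and ?A = "presented_algebra G S"
  interpret Q: ring ?Q
    by (rule ideal.quotient_is_ring[OF ideal_free_algebra[OF assms]])
  have eq: "carrier ?A = carrier ?Q" "monoid.mult ?A = monoid.mult ?Q" "one ?A = one ?Q"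
    "zero ?A = zero ?Q" "add ?A = add ?Q"
    by (simp_all add: presented_algebra_def Let_def)
  show ?thesis
  proof (rule ringI)
    show "abelian_group ?A"
    proof (rule abelian_groupI)
      show "\<exists>y\<in>carrier ?A. y \<oplus>\<^bsub>?A\<^esub> x = \<zero>\<^bsub>?A\<^esub>" if "x \<in> carrier ?A" for x
        unfolding eq using that Q.l_neg Q.a_inv_closed by (metis eq(1))
    qed (simp_all add: eq Q.a_assoc, simp add: Q.a_comm)
    show "Group.monoid ?A"
      by (rule monoidI) (simp_all add: eq Q.m_assoc)
  qed (simp_all add: eq Q.l_distr Q.r_distr)
qed

lemma presented_class_hom:
  assumes S: "S \<subseteq> carrier (free_algebra G)"
  shows "presented_class G S \<in> alg_hom (free_algebra G) (presented_algebra G S)"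
proof -
  interpret I: ideal "Idl\<^bsub>free_algebra G\<^esub> S" "free_algebra G" by (rule ideal_free_algebra[OF S])
  have "presented_class G S \<in> ring_hom (free_algebra G) (presented_algebra G S)"
    using I.rcos_ring_hom
    by (auto simp: ring_hom_def presented_algebra_def Let_def presented_class_def)
  then show ?thesis
    using S by (simp add: alg_hom_def presented_class_smult) (simp add: free_algebra_def)
qed


section \<open>The algebra \<open>U(osp(1|2))\<close>\<close>

datatype osp_gen = gen_Fp | gen_Fm | gen_H | gen_Ep | gen_Em | gen_P

definition osp_relations :: "(osp_gen list \<Rightarrow>\<^sub>0 complex) set" where
  "osp_relations =
    (let Fp = free_gen gen_Fp; Fm = free_gen gen_Fm; H = free_gen gen_H;
         Ep = free_gen gen_Ep; Em = free_gen gen_Em; P = free_gen gen_P;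
         comm = (\<lambda>X Y. X * Y - Y * X); acomm = (\<lambda>X Y. X * Y + Y * X)
     in {comm H Ep - Ep, comm H Em - (- Em), comm Ep Em - 2 *\<^sub>C H,
         comm H Fp - (1/2) *\<^sub>C Fp, comm H Fm - (- (1/2)) *\<^sub>C Fm,
         acomm Fp Fm - (1/2) *\<^sub>C H,
         comm Ep Fm - (- Fp), comm Em Fp - (- Fm),
         acomm Fp Fp - (1/2) *\<^sub>C Ep, acomm Fm Fm - (- (1/2)) *\<^sub>C Em,
         comm P Ep, comm P Em, comm P H, acomm P Fp, acomm P Fm, P * P - 1})"

lemma carrier_free_UNIV [simp]: "carrier (free_algebra UNIV) = UNIV"
  by (simp add: free_algebra_def)

typedef osp_U = "carrier (presented_algebra UNIV osp_relations)"
  unfolding carrier_presented carrier_free_UNIV by (rule exI, rule rangeI)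

definition U_class :: "(osp_gen list \<Rightarrow>\<^sub>0 complex) \<Rightarrow> osp_U" where
  "U_class f = Abs_osp_U (presented_class UNIV osp_relations f)"

instantiation osp_U :: complex_algebra_1
begin

definition zero_osp_U :: osp_U where
  "0 = Abs_osp_U \<zero>\<^bsub>presented_algebra UNIV osp_relations\<^esub>"
definition one_osp_U :: osp_U where
  "1 = Abs_osp_U \<one>\<^bsub>presented_algebra UNIV osp_relations\<^esub>"
definition plus_osp_U :: "osp_U \<Rightarrow> osp_U \<Rightarrow> osp_U" where
  "x + y = Abs_osp_U (Rep_osp_U x \<oplus>\<^bsub>presented_algebra UNIV osp_relations\<^esub> Rep_osp_U y)"
definition times_osp_U :: "osp_U \<Rightarrow> osp_U \<Rightarrow> osp_U" where
  "x * y = Abs_osp_U (Rep_osp_U x \<otimes>\<^bsub>presented_algebra UNIV osp_relations\<^esub> Rep_osp_U y)"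
definition uminus_osp_U :: "osp_U \<Rightarrow> osp_U" where
  "- x = Abs_osp_U (\<ominus>\<^bsub>presented_algebra UNIV osp_relations\<^esub> Rep_osp_U x)"
definition minus_osp_U :: "osp_U \<Rightarrow> osp_U \<Rightarrow> osp_U" where
  "x - y = x + (- y :: osp_U)"
definition scaleC_osp_U :: "complex \<Rightarrow> osp_U \<Rightarrow> osp_U" where
  "c *\<^sub>C x = Abs_osp_U (c \<odot>\<^bsub>presented_algebra UNIV osp_relations\<^esub> Rep_osp_U x)"

lemma U_class_surj: "\<exists>f. x = U_class f"
  using Rep_osp_U[of x] Rep_osp_U_inverse[of x]
  by (auto simp: U_class_def carrier_presented)

lemma Rep_U_class: "Rep_osp_U (U_class f) = presented_class UNIV osp_relations f"
  unfolding U_class_def by (rule Abs_osp_U_inverse) (simp add: carrier_presented)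

lemma U_class_simps:
  "U_class 0 = 0" "U_class 1 = 1" "U_class (f + g) = U_class f + U_class g"
  "U_class (f * g) = U_class f * U_class g" "U_class (c *\<^sub>C f) = c *\<^sub>C U_class f"
  "U_class (- f) = - U_class f"
proof -
  let ?A = "presented_algebra UNIV osp_relations" and ?p = "presented_class UNIV osp_relations"
  interpret A: ring ?A by (rule ring_presented) simp
  have h: "?p \<in> alg_hom (free_algebra UNIV) ?A" by (rule presented_class_hom) simp
  then have add: "?p (f + g) = ?p f \<oplus>\<^bsub>?A\<^esub> ?p g" and mult: "?p (f * g) = ?p f \<otimes>\<^bsub>?A\<^esub> ?p g"
    and scale: "?p (c *\<^sub>C f) = c \<odot>\<^bsub>?A\<^esub> ?p f" and one: "?p 1 = \<one>\<^bsub>?A\<^esub>"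
    and cl: "?p f \<in> carrier ?A" for f g c
    by (auto simp: alg_hom_def ring_hom_def free_algebra_def)
  have zero: "?p 0 = \<zero>\<^bsub>?A\<^esub>"
    using add[of 0 0] cl by (metis A.add.l_cancel_one add_0)
  have minus: "?p (- f) = \<ominus>\<^bsub>?A\<^esub> ?p f" for f
    using add[of "- f" f] cl zero by (metis A.minus_equality ab_left_minus)
  show "U_class 0 = 0" "U_class 1 = 1" "U_class (f + g) = U_class f + U_class g"
    "U_class (f * g) = U_class f * U_class g" "U_class (c *\<^sub>C f) = c *\<^sub>C U_class f"
    "U_class (- f) = - U_class f"
    unfolding zero_osp_U_def one_osp_U_def plus_osp_U_def times_osp_U_def scaleC_osp_U_def
      uminus_osp_U_def Rep_U_class
    by (simp_all add: U_class_def add mult scale one zero minus)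
qed

instance
proof
  fix a b c :: osp_U and r s :: complex
  obtain f g h where e: "a = U_class f" "b = U_class g" "c = U_class h"
    using U_class_surj by metis
  note u = e U_class_simps[symmetric]
  show "a + b + c = a + (b + c)" "a + b = b + a" "0 + a = a" "- a + a = 0"
    "a * b * c = a * (b * c)" "1 * a = a" "a * 1 = a"
    "(a + b) * c = a * c + b * c" "a * (b + c) = a * b + a * c"
    "r *\<^sub>C (a + b) = r *\<^sub>C a + r *\<^sub>C b" "(r + s) *\<^sub>C a = r *\<^sub>C a + s *\<^sub>C a"
    "r *\<^sub>C s *\<^sub>C a = (r * s) *\<^sub>C a" "1 *\<^sub>C a = a"
    "(r *\<^sub>C a) * b = r *\<^sub>C (a * b)" "a * (r *\<^sub>C b) = r *\<^sub>C (a * b)"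
    unfolding u by (simp_all add: algebra_simps scaleC_add_right scaleC_add_left scaleC_scaleC
        mult_scaleC_left mult_scaleC_right scaleC_one)
  show "a - b = a + - b" by (simp add: minus_osp_U_def)
qed

end

definition U_algebra :: "(complex, osp_U) module" where
  "U_algebra = \<lparr>carrier = UNIV, mult = (*), one = 1, zero = 0, add = (+), smult = (*\<^sub>C)\<rparr>"

definition U_gen :: "osp_gen \<Rightarrow> osp_U" where
  "U_gen g = U_class (free_gen g)"

lemma U_class_relation:
  assumes "f \<in> osp_relations"
  shows "U_class f = 0"
proof -
  let ?F = "free_algebra (UNIV :: osp_gen set)"
  interpret I: ideal "Idl\<^bsub>?F\<^esub> osp_relations" ?F by (rule ideal_free_algebra) simp
  have "f \<in> Idl\<^bsub>?F\<^esub> osp_relations"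
    using I.genideal_self assms by fastforce
  then have "f \<in> Idl\<^bsub>?F\<^esub> osp_relations +>\<^bsub>?F\<^esub> 0"
    by (force simp: a_r_coset_def r_coset_def free_algebra_def)
  then have "presented_class UNIV osp_relations 0 = presented_class UNIV osp_relations f"
    unfolding presented_class_def by (rule I.a_repr_independence') simp
  then show ?thesis
    by (metis U_class_def U_class_simps(1))
qed

lemma U_P_square: "U_gen gen_P * U_gen gen_P = 1"
proof -
  have "U_class (free_gen gen_P * free_gen gen_P + - 1) = 0"
    by (rule U_class_relation) (simp add: osp_relations_def Let_def)
  then show ?thesis by (simp only: U_class_simps U_gen_def) simp
qed

definition casimir :: osp_U where
  "casimir = (let Fp = U_gen gen_Fp; Fm = U_gen gen_Fm; P = U_gen gen_P
              in 8 *\<^sub>C ((Fp * Fm - Fm * Fp) * P) + P)"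


section \<open>Tensor powers of \<open>U(osp(1|2))\<close>\<close>

text \<open>
  The type \<open>tens\<close> is the direct sum of all tensor powers of \<open>U\<close>: the vector space with basis
  the tuples (lists) of elements of \<open>U\<close>, modulo additivity and homogeneity in each entry.
  The relations only involve tuples of equal length, so the tuples of length \<open>n\<close> span the
  \<open>n\<close>-th tensor power. The multiplication \<open>*\<close> of \<open>tens\<close> is the ordinary (sign-free)
  componentwise product of tensors of equal degree (and 0 for different degrees), hence \<open>tens\<close> has no unit but each tensor power
  has one; the product \<open>\<boxtimes>\<close>, given by concatenation of tuples, is the outer tensor product.
\<close>

definition multilinearity :: "(osp_U list \<Rightarrow>\<^sub>0 complex) set" where
  "multilinearity =
     {Poly_Mapping.single (xs @ [a + b] @ ys) 1 - Poly_Mapping.single (xs @ [a] @ ys) 1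
        - Poly_Mapping.single (xs @ [b] @ ys) 1 | xs a b ys. True} \<union>
     {Poly_Mapping.single (xs @ [c *\<^sub>C a] @ ys) 1 - c *\<^sub>C Poly_Mapping.single (xs @ [a] @ ys) 1
        | xs c a ys. True}"

definition tens_rel :: "(osp_U list \<Rightarrow>\<^sub>0 complex) \<Rightarrow> (osp_U list \<Rightarrow>\<^sub>0 complex) \<Rightarrow> bool" where
  "tens_rel f g \<longleftrightarrow> f - g \<in> cvs.span multilinearity"

quotient_type tens = "osp_U list \<Rightarrow>\<^sub>0 complex" / tens_rel
proof (rule equivpI)
  show "reflp tens_rel" by (auto simp: reflp_def tens_rel_def cvs.span_zero)
  show "symp tens_rel"
  proof (rule sympI)
    fix f g assume "tens_rel f g"
    then show "tens_rel g f"
      using cvs.span_neg[of "f - g" multilinearity] by (simp add: tens_rel_def)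
  qed
  show "transp tens_rel"
  proof (rule transpI)
    fix f g h assume "tens_rel f g" "tens_rel g h"
    then show "tens_rel f h"
      using cvs.span_add[of "f - g" multilinearity "g - h"] by (simp add: tens_rel_def)
  qed
qed

definition comp_basis :: "osp_U list \<Rightarrow> osp_U list \<Rightarrow> (osp_U list \<Rightarrow>\<^sub>0 complex)" where
  "comp_basis v w =
     (if length v = length w then Poly_Mapping.single (map2 (*) v w) 1 else 0)"

definition comp_mult ::
  "(osp_U list \<Rightarrow>\<^sub>0 complex) \<Rightarrow> (osp_U list \<Rightarrow>\<^sub>0 complex) \<Rightarrow> (osp_U list \<Rightarrow>\<^sub>0 complex)" where
  "comp_mult f g = pm_extend (\<lambda>v. pm_extend (comp_basis v) g) f"

lemma comp_mult_simps:
  "comp_mult (f1 + f2) g = comp_mult f1 g + comp_mult f2 g"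
  "comp_mult f (g1 + g2) = comp_mult f g1 + comp_mult f g2"
  "comp_mult (c *\<^sub>C f) g = c *\<^sub>C comp_mult f g"
  "comp_mult f (c *\<^sub>C g) = c *\<^sub>C comp_mult f g"
  "comp_mult (f1 - f2) g = comp_mult f1 g - comp_mult f2 g"
  "comp_mult f (g1 - g2) = comp_mult f g1 - comp_mult f g2"
  "comp_mult 0 g = 0" "comp_mult f 0 = 0"
  "comp_mult (Poly_Mapping.single v 1) (Poly_Mapping.single w 1) = comp_basis v w"
proof -
  show a: "comp_mult f (g1 + g2) = comp_mult f g1 + comp_mult f g2" for f g1 g2
    by (simp add: comp_mult_def pm_extend_add pm_extend_fun_add)
  show "comp_mult f (g1 - g2) = comp_mult f g1 - comp_mult f g2"
    using a[of f "g1 - g2" g2] by simp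
  show "comp_mult f 0 = 0"
    by (simp add: comp_mult_def pm_extend_def)
qed (simp_all add: comp_mult_def pm_extend_add pm_extend_scaleC pm_extend_fun_scaleC
      pm_extend_minus scaleC_one)

lemma comp_mult_assoc: "comp_mult (comp_mult f g) h = comp_mult f (comp_mult g h)"
proof (induction f rule: pm_linear_induct)
  case (single u)
  show ?case
  proof (induction g rule: pm_linear_induct)
    case (single v)
    show ?case
    proof (induction h rule: pm_linear_induct)
      case (single w)
      show ?case
        by (auto simp: comp_mult_simps comp_basis_def mult.assoc intro!: arg_cong2[where f=Poly_Mapping.single]
            nth_equalityI)
    qed (simp_all add: comp_mult_simps)
  qed (simp_all add: comp_mult_simps)
qed (simp_all add: comp_mult_simps)

lemma multilinearity_add:
  "Poly_Mapping.single (xs @ (a + b) # ys) 1 - Poly_Mapping.single (xs @ a # ys) 1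
        - Poly_Mapping.single (xs @ b # ys) 1 \<in> cvs.span multilinearity"
  by (rule cvs.span_base) (auto simp: multilinearity_def)

lemma multilinearity_scaleC:
  "Poly_Mapping.single (xs @ (c *\<^sub>C a) # ys) 1 - c *\<^sub>C Poly_Mapping.single (xs @ a # ys) 1
     \<in> cvs.span multilinearity"
  by (rule cvs.span_base) (simp add: multilinearity_def, blast)

lemma span_multilinearity_map:
  assumes add: "\<And>f g. L (f + g) = L f + L g" and scale: "\<And>c f. L (c *\<^sub>C f) = c *\<^sub>C L f"
    and minus: "\<And>f g. L (f - g) = L f - L g"
    and 1: "\<And>xs a b ys. L (Poly_Mapping.single (xs @ (a + b) # ys) 1)
      - L (Poly_Mapping.single (xs @ a # ys) 1) - L (Poly_Mapping.single (xs @ b # ys) 1) \<in> cvs.span M"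
    and 2: "\<And>xs c a ys. L (Poly_Mapping.single (xs @ (c *\<^sub>C a) # ys) 1)
      - c *\<^sub>C L (Poly_Mapping.single (xs @ a # ys) 1) \<in> cvs.span M"
    and f: "f \<in> cvs.span multilinearity"
  shows "L f \<in> cvs.span M"
  using f
proof (induction rule: cvs.span_induct_alt)
  case base
  show ?case using scale[of 0 0] by (simp add: cvs.span_zero)
next
  case (step c x y)
  have "L x \<in> cvs.span M"
    using step(1) 1 2 by (auto simp: multilinearity_def minus scale)
  with step(2) show ?case
    by (simp add: add scale cvs.span_add cvs.span_scale)
qed

lemma comp_mult_span:
  assumes "f \<in> cvs.span multilinearity"
  shows "comp_mult f g \<in> cvs.span multilinearity" "comp_mult g f \<in> cvs.span multilinearity"
proof -
  let ?V = "cvs.span multilinearity"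
  have map2_split: "\<exists>us u vs. w = us @ u # vs \<and> length us = length xs \<and> length vs = length ys"
    if "length w = Suc (length xs + length ys)" for w xs ys :: "osp_U list"
  proof (intro exI conjI)
    show "w = take (length xs) w @ w ! length xs # drop (Suc (length xs)) w"
      using that by (simp add: id_take_nth_drop)
  qed (use that in auto)
  show "comp_mult f g \<in> ?V"
  proof (induction g rule: pm_linear_induct)
    case (single w)
    show ?case
    proof (rule span_multilinearity_map[where L = "\<lambda>f. comp_mult f (Poly_Mapping.single w 1)",
            OF _ _ _ _ _ assms])
      fix xs ys :: "osp_U list" and a b :: osp_U and c :: complex
      show "comp_mult (Poly_Mapping.single (xs @ (a + b) # ys) 1) (Poly_Mapping.single w 1) -
        comp_mult (Poly_Mapping.single (xs @ a # ys) 1) (Poly_Mapping.single w 1) -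
        comp_mult (Poly_Mapping.single (xs @ b # ys) 1) (Poly_Mapping.single w 1) \<in> ?V"
      proof (cases "length w = Suc (length xs + length ys)")
        case True
        then obtain us u vs where "w = us @ u # vs" "length us = length xs" "length vs = length ys"
          using map2_split by blast
        then show ?thesis
          by (simp add: comp_mult_simps comp_basis_def distrib_right multilinearity_add)
      qed (auto simp: comp_mult_simps comp_basis_def cvs.span_zero)
      show "comp_mult (Poly_Mapping.single (xs @ (c *\<^sub>C a) # ys) 1) (Poly_Mapping.single w 1) -
        c *\<^sub>C comp_mult (Poly_Mapping.single (xs @ a # ys) 1) (Poly_Mapping.single w 1) \<in> ?V"
      proof (cases "length w = Suc (length xs + length ys)")
        case True
        then obtain us u vs where "w = us @ u # vs" "length us = length xs" "length vs = length ys"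
          using map2_split by blast
        then show ?thesis
          by (simp add: comp_mult_simps comp_basis_def mult_scaleC_left multilinearity_scaleC)
      qed (auto simp: comp_mult_simps comp_basis_def cvs.span_zero)
    qed (simp_all add: comp_mult_simps)
  qed (simp_all add: comp_mult_simps cvs.span_add cvs.span_scale)
  show "comp_mult g f \<in> ?V"
  proof (induction g rule: pm_linear_induct)
    case (single w)
    show ?case
    proof (rule span_multilinearity_map[where L = "\<lambda>f. comp_mult (Poly_Mapping.single w 1) f",
            OF _ _ _ _ _ assms])
      fix xs ys :: "osp_U list" and a b :: osp_U and c :: complex
      show "comp_mult (Poly_Mapping.single w 1) (Poly_Mapping.single (xs @ (a + b) # ys) 1) -
        comp_mult (Poly_Mapping.single w 1) (Poly_Mapping.single (xs @ a # ys) 1) -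
        comp_mult (Poly_Mapping.single w 1) (Poly_Mapping.single (xs @ b # ys) 1) \<in> ?V"
      proof (cases "length w = Suc (length xs + length ys)")
        case True
        then obtain us u vs where "w = us @ u # vs" "length us = length xs" "length vs = length ys"
          using map2_split by blast
        then show ?thesis
          by (simp add: comp_mult_simps comp_basis_def distrib_left multilinearity_add)
      qed (auto simp: comp_mult_simps comp_basis_def cvs.span_zero)
      show "comp_mult (Poly_Mapping.single w 1) (Poly_Mapping.single (xs @ (c *\<^sub>C a) # ys) 1) -
        c *\<^sub>C comp_mult (Poly_Mapping.single w 1) (Poly_Mapping.single (xs @ a # ys) 1) \<in> ?V"
      proof (cases "length w = Suc (length xs + length ys)")
        case True
        then obtain us u vs where "w = us @ u # vs" "length us = length xs" "length vs = length ys"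
          using map2_split by blast
        then show ?thesis
          by (simp add: comp_mult_simps comp_basis_def mult_scaleC_right multilinearity_scaleC)
      qed (auto simp: comp_mult_simps comp_basis_def cvs.span_zero)
    qed (simp_all add: comp_mult_simps)
  qed (simp_all add: comp_mult_simps cvs.span_add cvs.span_scale)
qed

lemma concat_span:
  assumes "f \<in> cvs.span multilinearity"
  shows "f * g \<in> cvs.span multilinearity" "g * f \<in> cvs.span multilinearity"
proof -
  let ?V = "cvs.span multilinearity"
  show "f * g \<in> ?V"
  proof (induction g rule: pm_linear_induct)
    case (single w)
    show ?case
      by (rule span_multilinearity_map[where L = "\<lambda>f. f * Poly_Mapping.single w 1",
            OF _ _ _ _ _ assms])
        (simp_all add: mult_scaleC_left algebra_simps mult_single plus_list_def
          multilinearity_add[simplified algebra_simps] multilinearity_scaleC)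
  qed (simp_all add: distrib_left mult_scaleC_right cvs.span_add cvs.span_scale)
  show "g * f \<in> ?V"
  proof (induction g rule: pm_linear_induct)
    case (single w)
    show ?case
      by (rule span_multilinearity_map[where L = "\<lambda>f. Poly_Mapping.single w 1 * f",
            OF _ _ _ _ _ assms])
        (simp_all add: mult_scaleC_right algebra_simps mult_single plus_list_def
          multilinearity_add[of "w @ _", simplified algebra_simps append_assoc]
          multilinearity_scaleC[of "w @ _", simplified append_assoc])
  qed (simp_all add: distrib_right mult_scaleC_left cvs.span_add cvs.span_scale)
qed

lemma diff_diff_diff_swap: "(a - b) - (c - d) = (a - c) - (b - d)" for a :: "'a::ab_group_add"
  by (simp add: algebra_simps)

lemma bilinear_respects_tens_rel:
  assumes add: "\<And>f1 f2 g. m (f1 + f2) g = m f1 g + m f2 g" "\<And>f g1 g2. m f (g1 + g2) = m f g1 + m f g2"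
    and span: "\<And>f g. f \<in> cvs.span multilinearity \<Longrightarrow> m f g \<in> cvs.span multilinearity"
      "\<And>f g. f \<in> cvs.span multilinearity \<Longrightarrow> m g f \<in> cvs.span multilinearity"
    and rel: "tens_rel f f'" "tens_rel g g'"
  shows "tens_rel (m f g) (m f' g')"
proof -
  have "m f g = m (f - f') g + m f' (g - g') + m f' g'"
    by (simp add: add(1)[of "f - f'" f' g, simplified] add(2)[of f' "g - g'" g', simplified] add.assoc)
  then show ?thesis
    using rel span(1)[of "f - f'" g] span(2)[of "g - g'" f']
    by (simp add: tens_rel_def cvs.span_add)
qed

instantiation tens :: complex_algebra
begin

lift_definition zero_tens :: tens is 0 .
lift_definition plus_tens :: "tens \<Rightarrow> tens \<Rightarrow> tens" is "(+)"
  unfolding tens_rel_def add_diff_add by (rule cvs.span_add)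
lift_definition uminus_tens :: "tens \<Rightarrow> tens" is uminus
  unfolding tens_rel_def minus_diff_minus by (rule cvs.span_neg)
lift_definition minus_tens :: "tens \<Rightarrow> tens \<Rightarrow> tens" is "(-)"
  unfolding tens_rel_def by (subst diff_diff_diff_swap) (rule cvs.span_diff)
lift_definition scaleC_tens :: "complex \<Rightarrow> tens \<Rightarrow> tens" is "(*\<^sub>C)"
  unfolding tens_rel_def cvs.scale_right_diff_distrib[symmetric] by (rule cvs.span_scale)
lift_definition times_tens :: "tens \<Rightarrow> tens \<Rightarrow> tens" is comp_mult
  by (rule bilinear_respects_tens_rel[where m = comp_mult]) (simp_all add: comp_mult_simps comp_mult_span)

instance
proof -
  have eq: "tens_rel f g" if "f = g" for f g
    using that by (simp add: tens_rel_def cvs.span_zero)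
  show "OFCLASS(tens, complex_algebra_class)"
    by standard (transfer, rule eq, simp add: comp_mult_simps comp_mult_assoc algebra_simps
        scaleC_add_right scaleC_add_left scaleC_scaleC scaleC_one)+
qed

end

lift_definition tensor :: "tens \<Rightarrow> tens \<Rightarrow> tens"  (infixr \<open>\<boxtimes>\<close> 77)
  is "(*) :: _ \<Rightarrow> _ \<Rightarrow> osp_U list \<Rightarrow>\<^sub>0 complex"
  by (rule bilinear_respects_tens_rel[where m = "(*)"]) (simp_all add: algebra_simps concat_span)

lift_definition pure :: "osp_U list \<Rightarrow> tens" is "\<lambda>w. Poly_Mapping.single w 1" .

lemma pure_times_pure:
  "length v = length w \<Longrightarrow> pure v * pure w = pure (map2 (*) v w)"
  by transfer (simp add: comp_mult_simps comp_basis_def tens_rel_def cvs.span_zero)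

lemma pure_tensor_pure: "pure v \<boxtimes> pure w = pure (v @ w)"
  by transfer (simp add: mult_single plus_list_def tens_rel_def cvs.span_zero)

lemma pure_add: "pure (xs @ [a + b] @ ys) = pure (xs @ [a] @ ys) + pure (xs @ [b] @ ys)"
  by transfer (use multilinearity_add in \<open>simp add: tens_rel_def diff_diff_eq\<close>)

lemma pure_scaleC: "pure (xs @ [c *\<^sub>C a] @ ys) = c *\<^sub>C pure (xs @ [a] @ ys)"
  by transfer (use multilinearity_scaleC in \<open>simp add: tens_rel_def\<close>)

definition tensor_power :: "nat \<Rightarrow> (complex, tens) module" where
  "tensor_power n =
     \<lparr>carrier = cvs.span (pure ` {w. length w = n}), mult = (*), one = pure (replicate n 1),
      zero = 0, add = (+), smult = (*\<^sub>C)\<rparr>"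

text \<open>
  The linear extension of a function on pure tensors. The choice of a representative does not
  matter as soon as \<open>g\<close> is linear in each entry of its argument, for argument lists of every
  length; the functions to which it is applied below are defined so as to have this property.
\<close>

definition tensor_lift :: "(osp_U list \<Rightarrow> tens) \<Rightarrow> tens \<Rightarrow> tens" where
  "tensor_lift g t = pm_extend g (rep_tens t)"


section \<open>Coproduct, R-matrix and intermediate Casimir elements\<close>

definition comult :: "osp_U \<Rightarrow> tens" where
  "comult = (THE D. D \<in> alg_hom U_algebra (tensor_power 2) \<and>
     (\<forall>g\<in>{gen_Ep, gen_Em, gen_H}. D (U_gen g) = pure [U_gen g, 1] + pure [1, U_gen g]) \<and>
     (\<forall>g\<in>{gen_Fp, gen_Fm}. D (U_gen g) = pure [U_gen g, U_gen gen_P] + pure [1, U_gen g]) \<and>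
     D (U_gen gen_P) = pure [U_gen gen_P, U_gen gen_P])"

text \<open>The map \<open>id \<otimes> D\<close> on the second tensor power, for linear \<open>D\<close>.\<close>

definition id_tensor :: "(osp_U \<Rightarrow> tens) \<Rightarrow> tens \<Rightarrow> tens" where
  "id_tensor D = tensor_lift (\<lambda>w. case w of [x, y] \<Rightarrow> pure [x] \<boxtimes> D y | _ \<Rightarrow> 0)"

primrec comult_iter :: "nat \<Rightarrow> osp_U \<Rightarrow> tens" where
  "comult_iter 0 x = pure [x]"
| "comult_iter (Suc k) x = id_tensor (comult_iter k) (comult x)"

text \<open>Exchange of the tensor factors \<open>i\<close> and \<open>i + 1\<close>, where factors are numbered from 1.\<close>

definition swap_factors :: "nat \<Rightarrow> tens \<Rightarrow> tens" where
  "swap_factors i = tensor_lift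
     (\<lambda>w. pure (if 1 \<le> i \<and> i < length w then w[i - 1 := w ! i, i := w ! (i - 1)] else w))"

definition R_matrix :: tens where
  "R_matrix = (let P = U_gen gen_P
     in (1/2) *\<^sub>C (pure [1, 1] + pure [P, 1] + pure [1, P] - pure [P, P]))"

lemma R_matrix_square: "R_matrix * R_matrix = pure [1, 1]"
proof -
  let ?P = "U_gen gen_P"
  let ?S = "pure [1, 1] + pure [?P, 1] + pure [1, ?P] - pure [?P, ?P]"
  have "?S * ?S = pure [1, 1] + pure [1, 1] + (pure [1, 1] + pure [1, 1])"
    by (simp add: distrib_left distrib_right left_diff_distrib right_diff_distrib
        pure_times_pure U_P_square)
  also have "\<dots> = (1 + 1 + (1 + 1)) *\<^sub>C pure [1, 1]"
    by (simp only: scaleC_add_left scaleC_one)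
  finally show ?thesis
    by (simp add: R_matrix_def Let_def mult_scaleC_left mult_scaleC_right)
qed

definition R_adjacent :: "nat \<Rightarrow> nat \<Rightarrow> tens" where
  "R_adjacent n i = pure (replicate (i - 1) 1) \<boxtimes> R_matrix \<boxtimes> pure (replicate (n - i - 1) 1)"

text \<open>
  Conjugation by \<open>R\<^sub>i\<^sub>,\<^sub>i\<^sub>+\<^sub>1 \<sigma>\<^sub>i\<^sub>,\<^sub>i\<^sub>+\<^sub>1\<close>, where conjugation by \<open>\<sigma>\<^sub>i\<^sub>,\<^sub>i\<^sub>+\<^sub>1\<close> exchanges the tensor factors
  and \<open>R\<close> is its own inverse, cf. \<open>R_matrix_square\<close>.
\<close>

definition R_check_conj :: "nat \<Rightarrow> nat \<Rightarrow> tens \<Rightarrow> tens" where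
  "R_check_conj n i X = R_adjacent n i * swap_factors i X * R_adjacent n i"

text \<open>The word \<open>[i\<^sub>1, \<dots>, i\<^sub>p]\<close> stands for the product \<open>s\<^sub>i\<^sub>1 \<circ> \<dots> \<circ> s\<^sub>i\<^sub>p\<close> of adjacent transpositions.\<close>

definition word_perm :: "nat list \<Rightarrow> nat \<Rightarrow> nat" where
  "word_perm is = foldr (\<lambda>i s. transpose i (i + 1) \<circ> s) is id"

text \<open>
  The definite descriptions in \<open>perm_action\<close> and \<open>intermediate_casimir\<close> express that the
  results do not depend on the decomposition of \<open>s\<close>, respectively on the interval and on \<open>s\<close>.
\<close>

definition perm_action :: "nat \<Rightarrow> (nat \<Rightarrow> nat) \<Rightarrow> tens \<Rightarrow> tens" where
  "perm_action n s X = (THE Y. \<exists>is. set is \<subseteq> {1..<n} \<and> word_perm is = s \<and>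
     Y = foldr (R_check_conj n) is X)"

definition casimir_interval :: "nat \<Rightarrow> nat \<Rightarrow> nat \<Rightarrow> tens" where
  "casimir_interval n k l =
     pure (replicate (k - 1) 1) \<boxtimes> comult_iter (l - k) casimir \<boxtimes> pure (replicate (n - l) 1)"

definition intermediate_casimir :: "nat \<Rightarrow> nat set \<Rightarrow> tens" where
  "intermediate_casimir n A = (if A = {} then \<one>\<^bsub>tensor_power n\<^esub> else
     (THE X. \<exists>k l s. 1 \<le> k \<and> k \<le> l \<and> l \<le> n \<and> card {k..l} = card A \<and>
        s permutes {1..n} \<and> s ` {k..l} = A \<and> X = perm_action n s (casimir_interval n k l)))"


section \<open>The higher rank universal Bannai--Ito algebra\<close>

definition BI_relations :: "nat \<Rightarrow> (nat set list \<Rightarrow>\<^sub>0 complex) set" where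
  "BI_relations n = insert (free_gen {} - 1)
     {free_gen A * free_gen B + free_gen B * free_gen A
        - 2 *\<^sub>C (- free_gen ((A \<union> B) - (A \<inter> B))
               + free_gen (A - (A \<inter> B)) * free_gen (B - (A \<inter> B))
               + free_gen (A \<inter> B) * free_gen (A \<union> B))
      | A B. A \<subseteq> {1..n} \<and> B \<subseteq> {1..n}}"

definition BI :: "nat \<Rightarrow> (complex, (nat set list \<Rightarrow>\<^sub>0 complex) set) module" where
  "BI n = presented_algebra (Pow {1..n}) (BI_relations n)"

definition BI_gen :: "nat \<Rightarrow> nat set \<Rightarrow> (nat set list \<Rightarrow>\<^sub>0 complex) set" where
  "BI_gen n A = presented_class (Pow {1..n}) (BI_relations n) (free_gen A)"

end

theory Submission
  imports Defs
begin

text \<open>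
  The disguise of the super signs is undone by attaching the product of all later \<open>P\<^sub>j\<close> to
  \<open>F\<^sup>\<plusminus>\<^sub>i\<close>: the resulting elements \<open>f\<^sup>\<plusminus>\<^sub>i\<close> for different \<open>i\<close> anticommute, and conjugation by
  \<open>R\<^sub>i\<^sub>,\<^sub>i\<^sub>+\<^sub>1 \<sigma>\<^sub>i\<^sub>,\<^sub>i\<^sub>+\<^sub>1\<close> simply exchanges the indices \<open>i\<close> and \<open>i + 1\<close>. Hence, with
  \<open>f\<^sup>\<plusminus>\<^sub>A = \<Sum>i\<in>A. f\<^sup>\<plusminus>\<^sub>i\<close> and \<open>P\<^sub>A = \<Prod>i\<in>A. P\<^sub>i\<close>, every intermediate Casimir element is
  \<open>C\<^sub>A = 8 [f\<^sup>+\<^sub>A, f\<^sup>-\<^sub>A] P\<^sub>A + P\<^sub>A\<close>, which also shows that it does not depend on the choices made.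
  The triples \<open>(f\<^sup>+, f\<^sup>-, P)\<close> belonging to the disjoint sets \<open>A - B\<close>, \<open>A \<inter> B\<close> and \<open>B - A\<close> are three
  super-commuting copies of \<open>osp(1|2)\<close>, possibly trivial ones, so that all relations of the
  Bannai--Ito algebra reduce to a single identity for three such copies.
\<close>

text \<open>The Casimir element involves only \<open>F\<^sup>\<plusminus>\<close> and
  \<open>P\<close>, so \<open>E\<^sup>\<plusminus>\<close> and \<open>H\<close> can be eliminated.
  What remains of them are two cubic relations: \<open>[F\<^sup>+ F\<^sup>+, F\<^sup>-]\<close> is a
  multiple of \<open>F\<^sup>+\<close> and \<open>[F\<^sup>- F\<^sup>-, F\<^sup>+]\<close> a
  multiple of \<open>F\<^sup>-\<close>. Their odd degree lets them survive the attached
  \<open>P\<close>'s, since an odd power of \<open>P\<close> is \<open>P\<close>; they are additive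
  over anticommuting copies; and they make the Casimir element commute with
  \<open>F\<^sup>\<plusminus>\<close>. In the identity for three copies, the Casimir of a pair
  splits into terms of the single copies and one coupling term \<open>d i j\<close>. Two couplings
  that share copy \<open>j\<close> satisfy \<open>{d i j, d j k} = 2 [y j, x j] d i k\<close>. This
  formula is the heart of the Bannai--Ito relation; the other terms only require moving the
  \<open>p\<close>'s with the correct signs.\<close>

section \<open>Universal property of algebras given by generators and relations\<close>

definition alg_on :: "'b::complex_algebra set \<Rightarrow> 'b \<Rightarrow> (complex, 'b) module" where
  "alg_on V e = \<lparr>carrier = V, mult = (*), one = e, zero = 0, add = (+), smult = (*\<^sub>C)\<rparr>"

text \<open>\<open>tens\<close> contains all tensor powers at once and has no unit, so the target of
  a homomorphism is a subspace \<open>V\<close> with a unit \<open>e\<close> of its own.\<close>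

locale unital_subalgebra =
  fixes V :: "'b::complex_algebra set" and e :: 'b
  assumes subspace: "cvs.subspace V"
    and mult_closed: "x \<in> V \<Longrightarrow> y \<in> V \<Longrightarrow> x * y \<in> V"
    and unit_closed: "e \<in> V"
    and unit_left: "x \<in> V \<Longrightarrow> e * x = x"
    and unit_right: "x \<in> V \<Longrightarrow> x * e = x"

text \<open>The product ends in \<open>e\<close>, so that the empty word gives the unit. A
  one-letter word gives \<open>\<phi> g * e\<close>, hence the membership hypothesis of
  \<open>free_eval_free_gen\<close>.\<close>

definition word_eval :: "'b::complex_algebra \<Rightarrow> ('g \<Rightarrow> 'b) \<Rightarrow> 'g list \<Rightarrow> 'b" where
  "word_eval e \<phi> w = foldr (\<lambda>g t. \<phi> g * t) w e"

definition free_eval :: "'b::complex_algebra \<Rightarrow> ('g \<Rightarrow> 'b) \<Rightarrow> ('g list \<Rightarrow>\<^sub>0 complex) \<Rightarrow> 'b" where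
  "free_eval e \<phi> = pm_extend (word_eval e \<phi>)"

lemma word_eval_simps [simp]:
  "word_eval e \<phi> [] = e" "word_eval e \<phi> (g # w) = \<phi> g * word_eval e \<phi> w"
  by (simp_all add: word_eval_def)

lemma free_eval_linear:
  "free_eval e \<phi> (f + g) = free_eval e \<phi> f + free_eval e \<phi> g"
  "free_eval e \<phi> (f - g) = free_eval e \<phi> f - free_eval e \<phi> g"
  "free_eval e \<phi> (- f) = - free_eval e \<phi> f"
  "free_eval e \<phi> (c *\<^sub>C f) = c *\<^sub>C free_eval e \<phi> f"
  "free_eval e \<phi> 0 = 0"
  by (simp_all add: free_eval_def pm_extend_add pm_extend_minus pm_extend_uminus pm_extend_scaleC)

lemma pm_extend_sum: "pm_extend g (sum f T) = (\<Sum>t\<in>T. pm_extend g (f t))"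
  by (induction T rule: infinite_finite_induct) (simp_all add: pm_extend_add)

lemma pm_sum_singles:
  fixes f :: "'k \<Rightarrow>\<^sub>0 complex"
  shows "f = (\<Sum>k\<in>Poly_Mapping.keys f. Poly_Mapping.lookup f k *\<^sub>C Poly_Mapping.single k 1)"
  by (rule poly_mapping_eqI)
    (auto simp: lookup_sum lookup_single when_def in_keys_iff if_distrib cong: if_cong)

lemma free_algebra_simps:
  "mult (free_algebra G) = (*)" "one (free_algebra G) = 1" "zero (free_algebra G) = 0"
  "add (free_algebra G) = (+)" "smult (free_algebra G) = (*\<^sub>C)"
  by (simp_all add: free_algebra_def)

lemma alg_on_simps:
  "carrier (alg_on V e) = V" "mult (alg_on V e) = (*)" "one (alg_on V e) = e"
  "zero (alg_on V e) = 0" "add (alg_on V e) = (+)" "smult (alg_on V e) = (*\<^sub>C)"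
  by (simp_all add: alg_on_def)

lemma single_in_free_algebra: "w \<in> lists G \<Longrightarrow> Poly_Mapping.single w 1 \<in> carrier (free_algebra G)"
  by (simp add: free_algebra_def)

lemma free_gen_closed: "g \<in> G \<Longrightarrow> free_gen g \<in> carrier (free_algebra G)"
  unfolding free_gen_def by (rule single_in_free_algebra) simp

lemma free_algebra_closed:
  assumes "f \<in> carrier (free_algebra G)" "g \<in> carrier (free_algebra G)"
  shows "f + g \<in> carrier (free_algebra G)" "f * g \<in> carrier (free_algebra G)"
    "- f \<in> carrier (free_algebra G)" "f - g \<in> carrier (free_algebra G)"
    "0 \<in> carrier (free_algebra G)" "1 \<in> carrier (free_algebra G)"
proof -
  interpret ring "free_algebra G" by (rule ring_free_algebra)
  show s: "f + g \<in> carrier (free_algebra G)" and "f * g \<in> carrier (free_algebra G)"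
    "0 \<in> carrier (free_algebra G)" "1 \<in> carrier (free_algebra G)"
    using assms a_closed m_closed zero_closed one_closed by (simp_all add: free_algebra_simps)
  have u: "- h \<in> carrier (free_algebra G)" if "h \<in> carrier (free_algebra G)" for h
    using that by (auto simp: free_algebra_def in_keys_iff)
  then show "- f \<in> carrier (free_algebra G)" using assms by simp
  show "f - g \<in> carrier (free_algebra G)"
    using a_closed[OF assms(1) u[OF assms(2)]] by (simp add: free_algebra_simps)
qed

lemma alg_hom_to_alg_on:
  assumes "h \<in> alg_hom A (alg_on V e)"
  shows "\<And>x. x \<in> carrier A \<Longrightarrow> h x \<in> V"
    and "\<And>x y. x \<in> carrier A \<Longrightarrow> y \<in> carrier A \<Longrightarrow> h (x \<otimes>\<^bsub>A\<^esub> y) = h x * h y"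
    and "\<And>x y. x \<in> carrier A \<Longrightarrow> y \<in> carrier A \<Longrightarrow> h (x \<oplus>\<^bsub>A\<^esub> y) = h x + h y"
    and "h \<one>\<^bsub>A\<^esub> = e"
    and "\<And>c x. x \<in> carrier A \<Longrightarrow> h (c \<odot>\<^bsub>A\<^esub> x) = c *\<^sub>C h x"
  using assms by (auto simp: alg_hom_def ring_hom_def alg_on_simps)

lemma alg_hom_comp:
  assumes "f \<in> alg_hom A B" "g \<in> alg_hom B C"
  shows "g \<circ> f \<in> alg_hom A C"
  using assms by (auto simp: alg_hom_def intro: ring_hom_trans dest: ring_hom_closed)

context unital_subalgebra
begin

lemma word_eval_closed: "set w \<subseteq> G \<Longrightarrow> \<phi> ` G \<subseteq> V \<Longrightarrow> word_eval e \<phi> w \<in> V"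
  by (induction w) (auto simp: unit_closed intro!: mult_closed)

lemma word_eval_append:
  "set v \<subseteq> G \<Longrightarrow> set w \<subseteq> G \<Longrightarrow> \<phi> ` G \<subseteq> V \<Longrightarrow>
    word_eval e \<phi> (v @ w) = word_eval e \<phi> v * word_eval e \<phi> w"
  by (induction v) (auto simp: unit_left word_eval_closed mult.assoc)

lemma free_eval_one: "free_eval e \<phi> 1 = e"
  by (simp add: free_eval_def zero_list_def scaleC_one flip: single_one)

lemma free_eval_free_gen: "\<phi> g \<in> V \<Longrightarrow> free_eval e \<phi> (free_gen g) = \<phi> g"
  by (simp add: free_eval_def free_gen_def scaleC_one unit_right)

lemma free_eval_closed:
  assumes "f \<in> carrier (free_algebra G)" "\<phi> ` G \<subseteq> V"
  shows "free_eval e \<phi> f \<in> V"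
  unfolding free_eval_def pm_extend_def
  by (rule cvs.subspace_sum[OF subspace], rule cvs.subspace_scale[OF subspace])
    (use assms in \<open>auto simp: free_algebra_def lists_eq_set intro!: word_eval_closed\<close>)

lemma free_eval_mult:
  assumes f: "f \<in> carrier (free_algebra G)" and g: "g \<in> carrier (free_algebra G)" and \<phi>: "\<phi> ` G \<subseteq> V"
  shows "free_eval e \<phi> (f * g) = free_eval e \<phi> f * free_eval e \<phi> g"
proof -
  let ?l = Poly_Mapping.lookup and ?k = Poly_Mapping.keys
  have "free_eval e \<phi> (f * g) = (\<Sum>v\<in>?k f. \<Sum>w\<in>?k g. ?l f v *\<^sub>C ?l g w *\<^sub>C word_eval e \<phi> (v @ w))"
    unfolding pm_mult_extend free_eval_def
    by (simp add: pm_extend_def[of _ f] pm_extend_def[of _ g] pm_extend_sum pm_extend_scaleC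
        cvs.scale_sum_right plus_list_def scaleC_one)
  also have "\<dots> = (\<Sum>v\<in>?k f. \<Sum>w\<in>?k g. (?l f v *\<^sub>C word_eval e \<phi> v) * (?l g w *\<^sub>C word_eval e \<phi> w))"
    using f g \<phi> by (intro sum.cong refl)
      (subst word_eval_append[of _ G], auto simp: free_algebra_def mult_scaleC_left mult_scaleC_right)
  also have "\<dots> = free_eval e \<phi> f * free_eval e \<phi> g"
    by (simp add: free_eval_def pm_extend_def sum_product)
  finally show ?thesis .
qed

lemma presented_algebra_hom_exists:
  assumes S: "S \<subseteq> carrier (free_algebra G)" and \<phi>: "\<phi> ` G \<subseteq> V"
    and rel: "\<And>s. s \<in> S \<Longrightarrow> free_eval e \<phi> s = 0"
  shows "\<exists>h \<in> alg_hom (presented_algebra G S) (alg_on V e).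
    \<forall>f\<in>carrier (free_algebra G). h (presented_class G S f) = free_eval e \<phi> f"
proof -
  let ?F = "free_algebra G" and ?A = "presented_algebra G S" and ?p = "presented_class G S"
  let ?K = "{f \<in> carrier ?F. free_eval e \<phi> f = 0}"
  interpret F: ring ?F by (rule ring_free_algebra)
  interpret I: ideal "Idl\<^bsub>?F\<^esub> S" ?F by (rule ideal_free_algebra[OF S])
  \<comment> \<open>The kernel of the evaluation is a two-sided ideal containing \<open>S\<close>,
    hence it contains the ideal that \<open>S\<close> generates.\<close>
  have "ideal ?K ?F"
  proof (rule idealI[OF ring_free_algebra])
    show "subgroup ?K (add_monoid ?F)"
    proof (rule F.add.subgroupI)
      show "\<ominus>\<^bsub>?F\<^esub> f \<in> ?K" if "f \<in> ?K" for f
      proof -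
        have "\<ominus>\<^bsub>?F\<^esub> f = - f"
          by (rule F.minus_equality) (use that in \<open>auto simp: free_algebra_simps free_algebra_closed\<close>)
        then show ?thesis using that by (auto simp: free_eval_linear free_algebra_closed)
      qed
      have "0 \<in> ?K" using F.zero_closed by (simp add: free_eval_linear free_algebra_simps)
      then show "?K \<noteq> {}" by blast
      fix f g assume "f \<in> ?K" "g \<in> ?K"
      then show "f \<oplus>\<^bsub>?F\<^esub> g \<in> ?K"
        by (simp add: free_eval_linear free_algebra_simps free_algebra_closed)
    qed blast
    fix f x assume "f \<in> ?K" "x \<in> carrier ?F"
    then show "x \<otimes>\<^bsub>?F\<^esub> f \<in> ?K" "f \<otimes>\<^bsub>?F\<^esub> x \<in> ?K"
      by (simp_all add: free_algebra_simps free_algebra_closed free_eval_mult[OF _ _ \<phi>])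
  qed
  then have kernel: "Idl\<^bsub>?F\<^esub> S \<subseteq> ?K"
    by (rule F.genideal_minimal) (use S rel in auto)
  \<comment> \<open>The evaluation is constant on each coset; \<open>the_elem\<close> extracts the
    common value.\<close>
  define h where "h X = the_elem (free_eval e \<phi> ` X)" for X
  have h: "h (?p f) = free_eval e \<phi> f" if f: "f \<in> carrier ?F" for f
  proof -
    have "f \<in> ?p f"
      unfolding presented_class_def using f by (rule I.a_rcos_self)
    moreover have "free_eval e \<phi> f' = free_eval e \<phi> f" if "f' \<in> ?p f" for f'
    proof -
      obtain i where "i \<in> Idl\<^bsub>?F\<^esub> S" "f' = i + f"
        using \<open>f' \<in> ?p f\<close>
        by (auto simp: presented_class_def a_r_coset_def r_coset_def free_algebra_simps)
      then show ?thesis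
        using kernel by (auto simp: free_eval_linear)
    qed
    ultimately have "free_eval e \<phi> ` ?p f = {free_eval e \<phi> f}"
      by (blast intro: sym)
    then show ?thesis by (simp add: h_def)
  qed
  have p: "?p \<in> alg_hom ?F ?A" by (rule presented_class_hom[OF S])
  have hom: "?p f \<otimes>\<^bsub>?A\<^esub> ?p g = ?p (f * g)" "?p f \<oplus>\<^bsub>?A\<^esub> ?p g = ?p (f + g)"
    if "f \<in> carrier ?F" "g \<in> carrier ?F" for f g
    using p that by (auto simp: alg_hom_def ring_hom_def free_algebra_simps)
  have one: "\<one>\<^bsub>?A\<^esub> = ?p 1"
    using p by (auto simp: alg_hom_def ring_hom_def free_algebra_simps)
  have one_closed: "1 \<in> carrier ?F"
    using F.one_closed by (simp add: free_algebra_simps)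
  have "h \<in> alg_hom ?A (alg_on V e)"
    unfolding alg_hom_def
  proof (intro CollectI conjI ring_hom_memI allI ballI)
    fix x y c assume "x \<in> carrier ?A" "y \<in> carrier ?A"
    then obtain f g where fg: "f \<in> carrier ?F" "g \<in> carrier ?F" "x = ?p f" "y = ?p g"
      unfolding carrier_presented by blast
    then show "h (x \<otimes>\<^bsub>?A\<^esub> y) = h x \<otimes>\<^bsub>alg_on V e\<^esub> h y" "h (x \<oplus>\<^bsub>?A\<^esub> y) = h x \<oplus>\<^bsub>alg_on V e\<^esub> h y"
      by (simp_all add: alg_on_simps hom h free_algebra_closed free_eval_linear free_eval_mult[OF _ _ \<phi>])
  next
    fix x c assume "x \<in> carrier ?A"
    then obtain f where f: "f \<in> carrier ?F" "x = ?p f"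
      unfolding carrier_presented by blast
    then show "h x \<in> carrier (alg_on V e)" "h (c \<odot>\<^bsub>?A\<^esub> x) = c \<odot>\<^bsub>alg_on V e\<^esub> h x"
      by (simp_all add: alg_on_simps h free_eval_linear free_eval_closed[OF _ \<phi>]
          presented_class_smult[OF S] free_algebra_scaleC_closed)
  qed (simp add: one h one_closed free_eval_one alg_on_simps)
  with h show ?thesis by blast
qed

lemma free_algebra_hom_eq_free_eval:
  assumes h: "h \<in> alg_hom (free_algebra G) (alg_on V e)" and f: "f \<in> carrier (free_algebra G)"
  shows "h f = free_eval e (h \<circ> free_gen) f"
proof -
  let ?F = "free_algebra G"
  interpret F: ring ?F by (rule ring_free_algebra)
  have hs: "h x \<in> V" "h (x * y) = h x * h y" "h (x + y) = h x + h y" "h 1 = e" "h (c *\<^sub>C x) = c *\<^sub>C h x"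
    if "x \<in> carrier ?F" "y \<in> carrier ?F" for x y c
    using alg_hom_to_alg_on[OF h] that by (simp_all add: free_algebra_simps)
  have z: "0 \<in> carrier ?F" using F.zero_closed by (simp add: free_algebra_simps)
  have h0: "h 0 = 0" using hs(3)[OF z z] by simp
  have word: "h (Poly_Mapping.single w 1) = word_eval e (h \<circ> free_gen) w" if "w \<in> lists G" for w
    using that
  proof (induction w)
    case Nil
    show ?case using hs(4)[OF z z] by (simp add: zero_list_def flip: single_one)
  next
    case (Cons g w)
    have "Poly_Mapping.single (g # w) 1 = free_gen g * Poly_Mapping.single w (1::complex)"
      by (simp add: free_gen_def mult_single plus_list_def)
    then show ?case
      using Cons by (simp add: hs(2) free_gen_closed single_in_free_algebra)
  qed
  let ?s = "\<lambda>w. Poly_Mapping.lookup f w *\<^sub>C Poly_Mapping.single w (1::complex)"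
  \<comment> \<open>Linearity of \<open>h\<close> is available only inside the carrier, so the
    induction also records that the partial sums stay there.\<close>
  have "sum ?s T \<in> carrier ?F \<and> h (sum ?s T) =
      (\<Sum>w\<in>T. Poly_Mapping.lookup f w *\<^sub>C word_eval e (h \<circ> free_gen) w)" if "T \<subseteq> Poly_Mapping.keys f" for T
    using finite_subset[OF that finite_keys] that
  proof (induction T)
    case empty
    then show ?case by (simp add: z h0)
  next
    case (insert w T)
    then have w: "w \<in> lists G" using f by (auto simp: free_algebra_def)
    have "?s w \<in> carrier ?F" and "h (?s w) = Poly_Mapping.lookup f w *\<^sub>C word_eval e (h \<circ> free_gen) w"
      using single_in_free_algebra[OF w] word[OF w]
      by (simp_all only: free_algebra_scaleC_closed hs(5)[OF _ z])
    then show ?case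
      using insert by (simp add: hs(3) free_algebra_closed comp_def)
  qed
  from this[OF subset_refl] show ?thesis
    by (simp add: free_eval_def pm_extend_def flip: pm_sum_singles)
qed

lemma presented_algebra_hom_unique:
  assumes S: "S \<subseteq> carrier (free_algebra G)"
    and h: "h \<in> alg_hom (presented_algebra G S) (alg_on V e)" "h' \<in> alg_hom (presented_algebra G S) (alg_on V e)"
    and eq: "\<And>g. g \<in> G \<Longrightarrow> h (presented_class G S (free_gen g)) = h' (presented_class G S (free_gen g))"
    and x: "x \<in> carrier (presented_algebra G S)"
  shows "h x = h' x"
proof -
  let ?p = "presented_class G S"
  obtain f where f: "f \<in> carrier (free_algebra G)" "x = ?p f"
    using x by (auto simp: carrier_presented)
  have "word_eval e (h \<circ> ?p \<circ> free_gen) w = word_eval e (h' \<circ> ?p \<circ> free_gen) w" if "w \<in> lists G" for w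
    using that by (induction w) (auto simp: eq)
  then have "free_eval e (h \<circ> ?p \<circ> free_gen) f = free_eval e (h' \<circ> ?p \<circ> free_gen) f"
    unfolding free_eval_def pm_extend_def using f by (intro sum.cong) (auto simp: free_algebra_def)
  then show ?thesis
    using free_algebra_hom_eq_free_eval[OF alg_hom_comp[OF presented_class_hom[OF S] h(1)] f(1)]
      free_algebra_hom_eq_free_eval[OF alg_hom_comp[OF presented_class_hom[OF S] h(2)] f(1)] f(2)
    by simp
qed

section \<open>Transfer of the universal property to the type \<open>osp_U\<close>\<close>

lemma U_hom_exists:
  assumes \<phi>: "range \<phi> \<subseteq> V" and rel: "\<And>s. s \<in> osp_relations \<Longrightarrow> free_eval e \<phi> s = 0"
  shows "\<exists>D \<in> alg_hom U_algebra (alg_on V e). \<forall>g. D (U_gen g) = \<phi> g"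
proof -
  let ?A = "presented_algebra UNIV osp_relations"
  obtain h where h: "h \<in> alg_hom ?A (alg_on V e)"
    and eq: "\<And>f. h (presented_class UNIV osp_relations f) = free_eval e \<phi> f"
    using presented_algebra_hom_exists[of osp_relations UNIV \<phi>] assms by auto
  have D: "(h \<circ> Rep_osp_U) (U_class f) = free_eval e \<phi> f" for f
    by (simp add: Rep_U_class eq)
  have "h \<circ> Rep_osp_U \<in> alg_hom U_algebra (alg_on V e)"
    unfolding alg_hom_def
  proof (intro CollectI conjI ring_hom_memI allI ballI)
    fix x y :: osp_U and c
    obtain f g where fg: "x = U_class f" "y = U_class g" using U_class_surj by metis
    show "(h \<circ> Rep_osp_U) x \<in> carrier (alg_on V e)"
      unfolding fg D alg_on_simps by (rule free_eval_closed[of _ UNIV]) (use \<phi> in auto)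
    show "(h \<circ> Rep_osp_U) (x \<otimes>\<^bsub>U_algebra\<^esub> y) = (h \<circ> Rep_osp_U) x \<otimes>\<^bsub>alg_on V e\<^esub> (h \<circ> Rep_osp_U) y"
      unfolding fg alg_on_simps using \<phi>
      by (simp add: U_algebra_def D free_eval_mult[of _ UNIV] del: comp_apply flip: U_class_simps)
    show "(h \<circ> Rep_osp_U) (x \<oplus>\<^bsub>U_algebra\<^esub> y) = (h \<circ> Rep_osp_U) x \<oplus>\<^bsub>alg_on V e\<^esub> (h \<circ> Rep_osp_U) y"
      unfolding fg alg_on_simps
      by (simp add: U_algebra_def D free_eval_linear del: comp_apply flip: U_class_simps)
    show "(h \<circ> Rep_osp_U) (c \<odot>\<^bsub>U_algebra\<^esub> x) = c \<odot>\<^bsub>alg_on V e\<^esub> (h \<circ> Rep_osp_U) x"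
      unfolding fg alg_on_simps
      by (simp add: U_algebra_def D free_eval_linear del: comp_apply flip: U_class_simps)
    show "(h \<circ> Rep_osp_U) \<one>\<^bsub>U_algebra\<^esub> = \<one>\<^bsub>alg_on V e\<^esub>"
      unfolding alg_on_simps
      by (simp add: U_algebra_def D free_eval_one del: comp_apply flip: U_class_simps)
  qed
  moreover have "(h \<circ> Rep_osp_U) (U_gen g) = \<phi> g" for g
    unfolding U_gen_def D using \<phi> by (intro free_eval_free_gen) auto
  ultimately show ?thesis by blast
qed

lemma U_hom_unique:
  assumes h: "h \<in> alg_hom U_algebra (alg_on V e)" "h' \<in> alg_hom U_algebra (alg_on V e)"
    and eq: "\<And>g. h (U_gen g) = h' (U_gen g)"
  shows "h = h'"
proof
  fix x
  have "U_class \<in> alg_hom (free_algebra UNIV) U_algebra"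
    by (auto simp: alg_hom_def ring_hom_def free_algebra_simps U_algebra_def U_class_simps)
  note c = alg_hom_comp[OF this]
  obtain f where f: "x = U_class f" using U_class_surj by metis
  have "h \<circ> U_class \<circ> free_gen = h' \<circ> U_class \<circ> free_gen"
    using eq by (auto simp: U_gen_def)
  then show "h x = h' x"
    using free_algebra_hom_eq_free_eval[OF c[OF h(1)], of f]
      free_algebra_hom_eq_free_eval[OF c[OF h(2)], of f] f by (simp add: comp_assoc)
qed

end

section \<open>Linear maps on tensors\<close>

definition multilinear :: "(osp_U list \<Rightarrow> tens) \<Rightarrow> bool" where
  "multilinear g \<longleftrightarrow>
     (\<forall>xs a b ys. g (xs @ [a + b] @ ys) = g (xs @ [a] @ ys) + g (xs @ [b] @ ys)) \<and>
     (\<forall>xs c a ys. g (xs @ [c *\<^sub>C a] @ ys) = c *\<^sub>C g (xs @ [a] @ ys))"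

lemma pure_abs: "pure w = abs_tens (Poly_Mapping.single w 1)"
  by (simp add: pure_def)

lemma multilinear_extend_span:
  assumes g: "multilinear g" and f: "f \<in> cvs.span multilinearity"
  shows "pm_extend g f = 0"
  using f
proof (induction rule: cvs.span_induct_alt)
  case base
  then show ?case by simp
next
  case (step c x y)
  have "pm_extend g x = 0"
    using step(1) g
    by (auto simp: multilinearity_def multilinear_def pm_extend_minus pm_extend_scaleC scaleC_one)
  then show ?case using step(2) by (simp add: pm_extend_add pm_extend_scaleC)
qed

text \<open>\<open>tensor_lift\<close> evaluates at the representative picked by
  \<open>rep_tens\<close>. Any other representative differs from it by an element of the span of
  \<open>multilinearity\<close>, where a multilinear \<open>g\<close> extends to zero.\<close>

lemma tensor_lift_abs:
  assumes "multilinear g"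
  shows "tensor_lift g (abs_tens f) = pm_extend g f"
proof -
  have "tens_rel (rep_tens (abs_tens f)) f"
    using Quotient_rep_abs[OF Quotient_tens] by (simp add: tens_rel_def cvs.span_zero)
  then have "pm_extend g (rep_tens (abs_tens f) - f) = 0"
    using multilinear_extend_span[OF assms] by (simp add: tens_rel_def)
  then show ?thesis by (simp add: tensor_lift_def pm_extend_minus)
qed

lemma tensor_lift_simps:
  assumes "multilinear g"
  shows "tensor_lift g (s + t) = tensor_lift g s + tensor_lift g t"
    and "tensor_lift g (c *\<^sub>C t) = c *\<^sub>C tensor_lift g t"
    and "tensor_lift g (pure w) = g w"
proof -
  obtain f f' where f: "s = abs_tens f" "t = abs_tens f'"
    by (metis Quotient_abs_rep[OF Quotient_tens])
  show "tensor_lift g (s + t) = tensor_lift g s + tensor_lift g t"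
    unfolding f plus_tens.abs_eq tensor_lift_abs[OF assms] by (rule pm_extend_add)
  show "tensor_lift g (c *\<^sub>C t) = c *\<^sub>C tensor_lift g t"
    unfolding f scaleC_tens.abs_eq tensor_lift_abs[OF assms] by (rule pm_extend_scaleC)
  show "tensor_lift g (pure w) = g w"
    unfolding pure_abs tensor_lift_abs[OF assms] by (simp add: scaleC_one)
qed

lemma tensor_linear:
  "(s + s') \<boxtimes> t = s \<boxtimes> t + s' \<boxtimes> t" "s \<boxtimes> (t + t') = s \<boxtimes> t + s \<boxtimes> t'"
  "(c *\<^sub>C s) \<boxtimes> t = c *\<^sub>C (s \<boxtimes> t)" "s \<boxtimes> (c *\<^sub>C t) = c *\<^sub>C (s \<boxtimes> t)"
proof -
  have eq: "tens_rel f g" if "f = g" for f g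
    using that by (simp add: tens_rel_def cvs.span_zero)
  show "(s + s') \<boxtimes> t = s \<boxtimes> t + s' \<boxtimes> t" "s \<boxtimes> (t + t') = s \<boxtimes> t + s \<boxtimes> t'"
    "(c *\<^sub>C s) \<boxtimes> t = c *\<^sub>C (s \<boxtimes> t)" "s \<boxtimes> (c *\<^sub>C t) = c *\<^sub>C (s \<boxtimes> t)"
    by (transfer, rule eq, simp add: algebra_simps mult_scaleC_left mult_scaleC_right)+
qed

lemma linear_eq_on_span:
  fixes L M :: "'a::complex_vector \<Rightarrow> 'b::complex_vector"
  assumes "\<And>x y. L (x + y) = L x + L y" "\<And>c x. L (c *\<^sub>C x) = c *\<^sub>C L x"
    and "\<And>x y. M (x + y) = M x + M y" "\<And>c x. M (c *\<^sub>C x) = c *\<^sub>C M x"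
    and "\<And>b. b \<in> B \<Longrightarrow> L b = M b" and t: "t \<in> cvs.span B"
  shows "L t = M t"
  using t
proof (induction rule: cvs.span_induct_alt)
  case base
  show ?case using assms(2)[of 0 0] assms(4)[of 0 0] by simp
qed (simp add: assms)

lemma linear_closed_on_span:
  fixes L :: "'a::complex_vector \<Rightarrow> 'b::complex_vector"
  assumes "\<And>x y. L (x + y) = L x + L y" "\<And>c x. L (c *\<^sub>C x) = c *\<^sub>C L x"
    and "\<And>b. b \<in> B \<Longrightarrow> L b \<in> cvs.span B'" and t: "t \<in> cvs.span B"
  shows "L t \<in> cvs.span B'"
  using t
proof (induction rule: cvs.span_induct_alt)
  case base
  show ?case using assms(2)[of 0 0] by (simp add: cvs.span_zero)
qed (simp add: assms cvs.span_add cvs.span_scale)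

section \<open>The tensor powers as unital algebras\<close>

abbreviation tens_deg :: "nat \<Rightarrow> tens set" where
  "tens_deg n \<equiv> cvs.span (pure ` {w. length w = n})"

abbreviation tens_one :: "nat \<Rightarrow> tens" where
  "tens_one n \<equiv> pure (replicate n 1)"

lemma tensor_power_alg_on: "tensor_power n = alg_on (tens_deg n) (tens_one n)"
  by (simp add: tensor_power_def alg_on_def)

lemma pure_in_tens_deg: "length w = n \<Longrightarrow> pure w \<in> tens_deg n"
  by (rule cvs.span_base) blast

lemma tens_deg_mult:
  assumes "s \<in> tens_deg n" "t \<in> tens_deg n"
  shows "s * t \<in> tens_deg n"
proof (rule linear_closed_on_span[where L = "\<lambda>s. s * t", OF _ _ _ assms(1)])
  fix u assume "u \<in> pure ` {w. length w = n}"
  then obtain v where v: "u = pure v" "length v = n" by blast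
  show "u * t \<in> tens_deg n"
    by (rule linear_closed_on_span[where L = "\<lambda>t. u * t", OF _ _ _ assms(2)])
      (use v in \<open>auto simp: algebra_simps mult_scaleC_right pure_times_pure intro!: pure_in_tens_deg\<close>)
qed (simp_all add: algebra_simps mult_scaleC_left)

lemma map2_one [simp]:
  fixes w :: "osp_U list"
  shows "length w = n \<Longrightarrow> map2 (*) (replicate n 1) w = w"
    and "length w = n \<Longrightarrow> map2 (*) w (replicate n 1) = w"
  by (auto intro!: nth_equalityI)

lemma tens_one_left: "t \<in> tens_deg n \<Longrightarrow> tens_one n * t = t"
  by (rule linear_eq_on_span[where L = "\<lambda>t. tens_one n * t" and M = "\<lambda>t. t"])
    (auto simp: algebra_simps mult_scaleC_right pure_times_pure)

lemma tens_one_right: "t \<in> tens_deg n \<Longrightarrow> t * tens_one n = t"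
  by (rule linear_eq_on_span[where L = "\<lambda>t. t * tens_one n" and M = "\<lambda>t. t"])
    (auto simp: algebra_simps mult_scaleC_left pure_times_pure)

global_interpretation tens: unital_subalgebra "tens_deg n" "tens_one n"
  by unfold_locales
    (simp_all add: tens_deg_mult tens_one_left tens_one_right pure_in_tens_deg)

lemma tensor_deg:
  assumes "s \<in> tens_deg m" "t \<in> tens_deg n"
  shows "s \<boxtimes> t \<in> tens_deg (m + n)"
proof (rule linear_closed_on_span[where L = "\<lambda>s. s \<boxtimes> t", OF _ _ _ assms(1)])
  fix u assume "u \<in> pure ` {w. length w = m}"
  then obtain v where v: "u = pure v" "length v = m" by blast
  show "u \<boxtimes> t \<in> tens_deg (m + n)"
    by (rule linear_closed_on_span[where L = "\<lambda>t. u \<boxtimes> t", OF _ _ _ assms(2)])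
      (use v in \<open>auto simp: tensor_linear pure_tensor_pure intro!: pure_in_tens_deg\<close>)
qed (simp_all add: tensor_linear)

text \<open>Matching degrees are essential: if \<open>a\<close> and \<open>c\<close> had different
  degrees, \<open>a * c\<close> would be 0, while the left side can be nonzero when the total
  degrees agree.\<close>

lemma tensor_mult_tensor:
  assumes a: "a \<in> tens_deg m" and c: "c \<in> tens_deg m" and b: "b \<in> tens_deg n" and d: "d \<in> tens_deg n"
  shows "(a \<boxtimes> b) * (c \<boxtimes> d) = (a * c) \<boxtimes> (b * d)"
proof (rule linear_eq_on_span[where L = "\<lambda>a. (a \<boxtimes> b) * (c \<boxtimes> d)"
      and M = "\<lambda>a. (a * c) \<boxtimes> (b * d)", OF _ _ _ _ _ a])
  fix a assume a: "a \<in> pure ` {w. length w = m}"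
  show "(a \<boxtimes> b) * (c \<boxtimes> d) = (a * c) \<boxtimes> (b * d)"
  proof (rule linear_eq_on_span[where L = "\<lambda>b. (a \<boxtimes> b) * (c \<boxtimes> d)"
        and M = "\<lambda>b. (a * c) \<boxtimes> (b * d)", OF _ _ _ _ _ b])
    fix b assume b: "b \<in> pure ` {w. length w = n}"
    show "(a \<boxtimes> b) * (c \<boxtimes> d) = (a * c) \<boxtimes> (b * d)"
    proof (rule linear_eq_on_span[where L = "\<lambda>c. (a \<boxtimes> b) * (c \<boxtimes> d)"
          and M = "\<lambda>c. (a * c) \<boxtimes> (b * d)", OF _ _ _ _ _ c])
      fix c assume c: "c \<in> pure ` {w. length w = m}"
      show "(a \<boxtimes> b) * (c \<boxtimes> d) = (a * c) \<boxtimes> (b * d)"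
        by (rule linear_eq_on_span[where L = "\<lambda>d. (a \<boxtimes> b) * (c \<boxtimes> d)"
              and M = "\<lambda>d. (a * c) \<boxtimes> (b * d)", OF _ _ _ _ _ d])
          (use a b c in \<open>auto simp: tensor_linear distrib_left mult_scaleC_right pure_tensor_pure pure_times_pure\<close>)
    qed (simp_all add: tensor_linear distrib_left distrib_right mult_scaleC_left mult_scaleC_right)
  qed (simp_all add: tensor_linear distrib_left distrib_right mult_scaleC_left mult_scaleC_right)
qed (simp_all add: tensor_linear distrib_left distrib_right mult_scaleC_left mult_scaleC_right)


section \<open>The coproduct and its iterates\<close>

text \<open>The relations are oriented as rewrite rules: \<open>P\<close> moves to the far right,
  \<open>H\<close> to the right of the other generators except \<open>P\<close>, and the squares of
  \<open>F\<^sup>\<plusminus>\<close> become multiples of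
  \<open>E\<^sup>\<plusminus>\<close>.\<close>

lemma U_relations:
  defines "Fp \<equiv> U_gen gen_Fp" and "Fm \<equiv> U_gen gen_Fm" and "H \<equiv> U_gen gen_H"
    and "Ep \<equiv> U_gen gen_Ep" and "Em \<equiv> U_gen gen_Em" and "P \<equiv> U_gen gen_P"
  shows "H * Ep = Ep * H + Ep" "H * Em = Em * H - Em" "Ep * Em = Em * Ep + 2 *\<^sub>C H"
    "H * Fp = Fp * H + (1/2) *\<^sub>C Fp" "H * Fm = Fm * H - (1/2) *\<^sub>C Fm"
    "Fp * Fm = (1/2) *\<^sub>C H - Fm * Fp"
    "Ep * Fm = Fm * Ep - Fp" "Em * Fp = Fp * Em - Fm"
    "Fp * Fp = (1/4) *\<^sub>C Ep" "Fm * Fm = - ((1/4) *\<^sub>C Em)"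
    "P * Ep = Ep * P" "P * Em = Em * P" "P * H = H * P" "P * Fp = - (Fp * P)" "P * Fm = - (Fm * P)"
    "P * P = 1"
proof -
  have eq: "U_class f = U_class g" if "f - g \<in> osp_relations" for f g
  proof -
    have "U_class (f - g + g) = U_class g"
      by (simp only: U_class_simps U_class_relation[OF that] add_0)
    then show ?thesis by simp
  qed
  have minus: "U_class (f - g) = U_class f - U_class g" for f g
    using U_class_simps(3)[of f "- g"] by (simp add: U_class_simps)
  have comm: "U_class f * U_class g = U_class g * U_class f + U_class z"
    if "f * g - g * f - z \<in> osp_relations" for f g z
    using eq[OF that] by (simp add: minus U_class_simps algebra_simps)
  have acomm: "U_class f * U_class g = U_class z - U_class g * U_class f"
    if "f * g + g * f - z \<in> osp_relations" for f g z
    using eq[OF that] by (simp add: minus U_class_simps algebra_simps)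
  have half: "x = (1/2) *\<^sub>C y" if "x + x = y" for x y :: osp_U
    using scaleC_add_left[of "1/2" "1/2" x] by (simp add: scaleC_one scaleC_add_right flip: that)
  note o = osp_relations_def Let_def
    and u = U_gen_def U_class_simps Fp_def Fm_def H_def Ep_def Em_def P_def
  show "H * Ep = Ep * H + Ep"
    using comm[of "free_gen gen_H" "free_gen gen_Ep" "free_gen gen_Ep"] by (simp add: o u)
  show "H * Em = Em * H - Em"
    using comm[of "free_gen gen_H" "free_gen gen_Em" "- free_gen gen_Em"] by (simp add: o u)
  show "Ep * Em = Em * Ep + 2 *\<^sub>C H"
    using comm[of "free_gen gen_Ep" "free_gen gen_Em" "2 *\<^sub>C free_gen gen_H"] by (simp add: o u)
  show "H * Fp = Fp * H + (1/2) *\<^sub>C Fp"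
    using comm[of "free_gen gen_H" "free_gen gen_Fp" "(1/2) *\<^sub>C free_gen gen_Fp"] by (simp add: o u)
  show "H * Fm = Fm * H - (1/2) *\<^sub>C Fm"
    using comm[of "free_gen gen_H" "free_gen gen_Fm" "(- (1/2)) *\<^sub>C free_gen gen_Fm"] by (simp add: o u)
  show "Fp * Fm = (1/2) *\<^sub>C H - Fm * Fp"
    using acomm[of "free_gen gen_Fp" "free_gen gen_Fm" "(1/2) *\<^sub>C free_gen gen_H"] by (simp add: o u)
  show "Ep * Fm = Fm * Ep - Fp"
    using comm[of "free_gen gen_Ep" "free_gen gen_Fm" "- free_gen gen_Fp"] by (simp add: o u)
  show "Em * Fp = Fp * Em - Fm"
    using comm[of "free_gen gen_Em" "free_gen gen_Fp" "- free_gen gen_Fm"] by (simp add: o u)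
  have "Fp * Fp + Fp * Fp = (1/2) *\<^sub>C Ep"
    using acomm[of "free_gen gen_Fp" "free_gen gen_Fp" "(1/2) *\<^sub>C free_gen gen_Ep"]
    by (simp add: o u eq_diff_eq)
  from half[OF this] show "Fp * Fp = (1/4) *\<^sub>C Ep" by (simp add: scaleC_scaleC)
  have "Fm * Fm + Fm * Fm = - ((1/2) *\<^sub>C Em)"
    using acomm[of "free_gen gen_Fm" "free_gen gen_Fm" "(- (1/2)) *\<^sub>C free_gen gen_Em"]
    by (simp add: o u eq_diff_eq)
  from half[OF this] show "Fm * Fm = - ((1/4) *\<^sub>C Em)" by (simp add: scaleC_scaleC)
  show "P * Ep = Ep * P"
    using comm[of "free_gen gen_P" "free_gen gen_Ep" "0"] by (simp add: o u)
  show "P * Em = Em * P"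
    using comm[of "free_gen gen_P" "free_gen gen_Em" "0"] by (simp add: o u)
  show "P * H = H * P"
    using comm[of "free_gen gen_P" "free_gen gen_H" "0"] by (simp add: o u)
  show "P * Fp = - (Fp * P)"
    using acomm[of "free_gen gen_P" "free_gen gen_Fp" "0"] by (simp add: o u)
  show "P * Fm = - (Fm * P)"
    using acomm[of "free_gen gen_P" "free_gen gen_Fm" "0"] by (simp add: o u)
  show "P * P = 1"
    unfolding P_def by (rule U_P_square)
qed

lemma pure_linear:
  "pure (xs @ (a + b) # ys) = pure (xs @ a # ys) + pure (xs @ b # ys)"
  "pure (xs @ (c *\<^sub>C a) # ys) = c *\<^sub>C pure (xs @ a # ys)"
  "pure (xs @ (- a) # ys) = - pure (xs @ a # ys)"
  "pure (xs @ (a - b) # ys) = pure (xs @ a # ys) - pure (xs @ b # ys)"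
  "pure (xs @ 0 # ys) = 0"
proof -
  show add: "pure (xs @ (a + b) # ys) = pure (xs @ a # ys) + pure (xs @ b # ys)" for a b
    using pure_add by simp
  show "pure (xs @ (c *\<^sub>C a) # ys) = c *\<^sub>C pure (xs @ a # ys)"
    using pure_scaleC by simp
  show zero: "pure (xs @ 0 # ys) = 0"
    using add[of 0 0] by simp
  show uminus: "pure (xs @ (- a) # ys) = - pure (xs @ a # ys)" for a
    using add[of a "- a"] zero by (metis add.right_inverse minus_unique)
  show "pure (xs @ (a - b) # ys) = pure (xs @ a # ys) - pure (xs @ b # ys)"
    using add[of a "- b"] by (simp add: uminus)
qed

definition comult_gen :: "osp_gen \<Rightarrow> tens" where
  "comult_gen g =
     (if g = gen_P then pure [U_gen gen_P, U_gen gen_P]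
      else if g \<in> {gen_Fp, gen_Fm} then pure [U_gen g, U_gen gen_P] + pure [1, U_gen g]
      else pure [U_gen g, 1] + pure [1, U_gen g])"

lemma comult_gen_in_tens_deg: "range comult_gen \<subseteq> tens_deg 2"
  by (auto simp: comult_gen_def intro!: cvs.span_add pure_in_tens_deg)

lemma tens_one_2: "tens_one 2 = pure [1, 1]"
  by (simp add: numeral_2_eq_2)

text \<open>The factor \<open>P\<close> makes \<open>F \<otimes> P\<close> anticommute with
  \<open>1 \<otimes> F'\<close> for odd \<open>F\<close> and \<open>F'\<close>, so the mixed terms
  drop out of the anticommutators of odd generators.\<close>

lemma comult_gen_relations:
  assumes "s \<in> osp_relations"
  shows "free_eval (tens_one 2) comult_gen s = 0"
proof -
  let ?ev = "free_eval (pure [1, 1]) comult_gen"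
  have mult: "?ev (f * g) = ?ev f * ?ev g" for f g
    unfolding tens_one_2[symmetric]
    by (rule tens.free_eval_mult[of _ UNIV]) (use comult_gen_in_tens_deg in auto)
  have gen: "?ev (free_gen g) = comult_gen g" for g
    unfolding tens_one_2[symmetric]
    by (rule tens.free_eval_free_gen) (use comult_gen_in_tens_deg in auto)
  have one: "?ev 1 = pure [1, 1]"
    unfolding tens_one_2[symmetric] by (rule tens.free_eval_one)
  \<comment> \<open>The square of \<open>F\<^sup>\<plusminus>\<close> has coefficient 1/4 and occurs
    twice in the anticommutator; splitting 1/2 accordingly lets the terms match.\<close>
  have half: "(1/2) *\<^sub>C x = (1/4) *\<^sub>C x + (1/4) *\<^sub>C x" for x :: tens
    by (simp flip: scaleC_add_left)
  note lin = pure_linear[of "[]"] pure_linear[of "[a]" for a]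
  show ?thesis
    using assms unfolding osp_relations_def Let_def tens_one_2
    by (elim insertE emptyE)
      (simp_all add: free_eval_linear mult gen one comult_gen_def
        distrib_left distrib_right pure_times_pure lin[simplified] U_relations scaleC_add_right
        half)
qed

lemma comult_hom: "comult \<in> alg_hom U_algebra (tensor_power 2)"
  and comult_U_gen: "comult (U_gen g) = comult_gen g"
proof -
  let ?Q = "\<lambda>D. D \<in> alg_hom U_algebra (tensor_power 2) \<and>
     (\<forall>g\<in>{gen_Ep, gen_Em, gen_H}. D (U_gen g) = pure [U_gen g, 1] + pure [1, U_gen g]) \<and>
     (\<forall>g\<in>{gen_Fp, gen_Fm}. D (U_gen g) = pure [U_gen g, U_gen gen_P] + pure [1, U_gen g]) \<and>
     D (U_gen gen_P) = pure [U_gen gen_P, U_gen gen_P]"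
  have Q_iff: "?Q D \<longleftrightarrow> D \<in> alg_hom U_algebra (tensor_power 2) \<and> (\<forall>g. D (U_gen g) = comult_gen g)" for D
  proof -
    have "(\<forall>g. R g) \<longleftrightarrow> R gen_Fp \<and> R gen_Fm \<and> R gen_H \<and> R gen_Ep \<and> R gen_Em \<and> R gen_P" for R
      by (metis (full_types) osp_gen.exhaust)
    then show ?thesis
      by (simp add: comult_gen_def) blast
  qed
  \<comment> \<open>The definite description defining \<open>comult\<close> is justified here, by
    the universal property of \<open>U\<close>.\<close>
  have "\<exists>!D. ?Q D"
  proof (rule ex_ex1I)
    show "\<exists>D. ?Q D"
      unfolding Q_iff unfolding tensor_power_alg_on
      using tens.U_hom_exists[OF comult_gen_in_tens_deg comult_gen_relations, simplified] by blast
    show "D = D'" if "?Q D" "?Q D'" for D D'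
      using that unfolding Q_iff unfolding tensor_power_alg_on by (intro tens.U_hom_unique) auto
  qed
  then have "?Q comult" unfolding comult_def by (rule theI')
  then show "comult \<in> alg_hom U_algebra (tensor_power 2)" "comult (U_gen g) = comult_gen g"
    unfolding Q_iff by auto
qed

lemma U_alg_hom_simps:
  assumes "h \<in> alg_hom U_algebra (tensor_power n)"
  shows "h x \<in> tens_deg n" "h (x * y) = h x * h y" "h (x + y) = h x + h y"
    "h 1 = tens_one n" "h (c *\<^sub>C x) = c *\<^sub>C h x" "h (x - y) = h x - h y"
proof -
  note s = alg_hom_to_alg_on[OF assms[unfolded tensor_power_alg_on]]
  show "h x \<in> tens_deg n" "h (x * y) = h x * h y" "h 1 = tens_one n" "h (c *\<^sub>C x) = c *\<^sub>C h x"
    using s by (simp_all add: U_algebra_def)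
  show add: "h (x + y) = h x + h y" for x y
    using s by (simp add: U_algebra_def)
  show "h (x - y) = h x - h y"
    using add[of "x - y" y] by simp
qed

section \<open>Iterated coproducts of \<open>P\<close> and of the odd generators\<close>

lemma id_tensor_simps:
  assumes "\<And>x y. D (x + y) = D x + D y" "\<And>c x. D (c *\<^sub>C x) = c *\<^sub>C D x"
  shows "id_tensor D (s + t) = id_tensor D s + id_tensor D t"
    and "id_tensor D (c *\<^sub>C t) = c *\<^sub>C id_tensor D t"
    and "id_tensor D (pure [x, y]) = pure [x] \<boxtimes> D y"
proof -
  let ?g = "\<lambda>w. case w of [x, y] \<Rightarrow> pure [x] \<boxtimes> D y | _ \<Rightarrow> 0"
  have "multilinear ?g"
    unfolding multilinear_def
  proof (intro conjI allI)
    fix xs ys :: "osp_U list" and a b c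
    consider y where "xs = []" "ys = [y]"
      | x where "xs = [x]" "ys = []" | "length xs + length ys \<noteq> 1"
      by (cases xs; cases ys) auto
    then have "?g (xs @ [a + b] @ ys) = ?g (xs @ [a] @ ys) + ?g (xs @ [b] @ ys) \<and>
      ?g (xs @ [c *\<^sub>C a] @ ys) = c *\<^sub>C ?g (xs @ [a] @ ys)"
    proof cases
      case 3
      have "?g w = 0" if "length w \<noteq> 2" for w
        using that by (auto split: list.splits)
      then show ?thesis using 3 by simp
    qed (simp_all add: assms tensor_linear pure_linear[where xs = "[]" and ys = "[]", simplified])
    then show "?g (xs @ [a + b] @ ys) = ?g (xs @ [a] @ ys) + ?g (xs @ [b] @ ys)"
      "?g (xs @ [c *\<^sub>C a] @ ys) = c *\<^sub>C ?g (xs @ [a] @ ys)" by blast+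
  qed
  note s = tensor_lift_simps[OF this]
  show "id_tensor D (s + t) = id_tensor D s + id_tensor D t"
    and "id_tensor D (c *\<^sub>C t) = c *\<^sub>C id_tensor D t"
    and "id_tensor D (pure [x, y]) = pure [x] \<boxtimes> D y"
    unfolding id_tensor_def by (simp_all add: s)
qed

lemma id_tensor_comult_hom:
  assumes D: "D \<in> alg_hom U_algebra (tensor_power n)"
  shows "(\<lambda>x. id_tensor D (comult x)) \<in> alg_hom U_algebra (tensor_power (Suc n))"
proof -
  note s = U_alg_hom_simps[OF D] and c = U_alg_hom_simps[OF comult_hom]
  note i = id_tensor_simps[OF s(3,5)]
  have pure2: "\<exists>x y. u = pure [x, y]" if "u \<in> pure ` {w. length w = 2}" for u
    using that by (auto simp: length_Suc_conv numeral_2_eq_2)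
  have closed: "id_tensor D t \<in> tens_deg (Suc n)" if "t \<in> tens_deg 2" for t
    by (rule linear_closed_on_span[OF _ _ _ that])
      (use pure2 tensor_deg[of _ 1 _ n] s(1) in \<open>fastforce simp: i pure_in_tens_deg\<close>)+
  have mult: "id_tensor D (t * u) = id_tensor D t * id_tensor D u" if t: "t \<in> tens_deg 2" and u: "u \<in> tens_deg 2" for t u
  proof (rule linear_eq_on_span[where L = "\<lambda>t. id_tensor D (t * u)"
        and M = "\<lambda>t. id_tensor D t * id_tensor D u", OF _ _ _ _ _ t])
    fix t assume "t \<in> pure ` {w. length w = 2}"
    then obtain x y where t: "t = pure [x, y]" using pure2 by blast
    show "id_tensor D (t * u) = id_tensor D t * id_tensor D u"
    proof (rule linear_eq_on_span[where L = "\<lambda>u. id_tensor D (t * u)"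
          and M = "\<lambda>u. id_tensor D t * id_tensor D u", OF _ _ _ _ _ u])
      fix u assume "u \<in> pure ` {w. length w = 2}"
      then obtain x' y' where "u = pure [x', y']" using pure2 by blast
      then show "id_tensor D (t * u) = id_tensor D t * id_tensor D u"
        by (simp add: t i pure_times_pure s(2) tensor_mult_tensor[OF _ _ s(1) s(1), of _ 1] pure_in_tens_deg)
    qed (simp_all add: i distrib_left mult_scaleC_right)
  qed (simp_all add: i distrib_right mult_scaleC_left)
  have one: "id_tensor D (tens_one 2) = tens_one (Suc n)"
    by (simp add: tens_one_2 i s pure_tensor_pure)
  show ?thesis
    unfolding alg_hom_def tensor_power_alg_on
    by (intro CollectI conjI ring_hom_memI allI ballI)
      (simp_all add: alg_on_simps U_algebra_def c i closed mult one)
qed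

lemma comult_iter_hom: "comult_iter k \<in> alg_hom U_algebra (tensor_power (Suc k))"
proof (induction k)
  case 0
  have "comult_iter 0 = (\<lambda>x. pure [x])" by auto
  then show ?case
    unfolding alg_hom_def tensor_power_alg_on
    by (intro CollectI conjI ring_hom_memI allI ballI)
      (simp_all add: alg_on_simps U_algebra_def pure_in_tens_deg pure_times_pure
        pure_linear[where xs = "[]" and ys = "[]", simplified] pure_linear(2)[of "[]" _ _ "[]", simplified])
next
  case (Suc k)
  have "comult_iter (Suc k) = (\<lambda>x. id_tensor (comult_iter k) (comult x))" by auto
  then show ?case using id_tensor_comult_hom[OF Suc] by simp
qed

lemma comult_iter_P: "comult_iter k (U_gen gen_P) = pure (replicate (Suc k) (U_gen gen_P))"
proof (induction k)
  case (Suc k)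
  note s = U_alg_hom_simps[OF comult_iter_hom[of k]]
  show ?case
    using Suc by (simp add: comult_U_gen comult_gen_def id_tensor_simps[OF s(3,5)] pure_tensor_pure)
qed simp

lemma tensor_sum: "s \<boxtimes> sum f T = (\<Sum>t\<in>T. s \<boxtimes> f t)" "sum f T \<boxtimes> s = (\<Sum>t\<in>T. f t \<boxtimes> s)"
proof -
  have "s \<boxtimes> 0 = 0" "0 \<boxtimes> s = 0"
    using tensor_linear(2)[of s 0 0] tensor_linear(1)[of 0 0 s] by simp_all
  then show "s \<boxtimes> sum f T = (\<Sum>t\<in>T. s \<boxtimes> f t)" "sum f T \<boxtimes> s = (\<Sum>t\<in>T. f t \<boxtimes> s)"
    by (induction T rule: infinite_finite_induct) (simp_all add: tensor_linear)
qed

text \<open>The iteration acts on the second factor: \<open>F \<otimes> P\<close> becomes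
  \<open>F\<close> followed by \<open>P\<close>'s, and \<open>1 \<otimes> F\<close> shifts all
  earlier terms by one place. The trailing \<open>P\<close>'s of \<open>odd_at\<close> originate
  here.\<close>

lemma comult_iter_F:
  assumes "g \<in> {gen_Fp, gen_Fm}"
  shows "comult_iter k (U_gen g) =
    (\<Sum>i\<le>k. pure (replicate i 1 @ [U_gen g] @ replicate (k - i) (U_gen gen_P)))"
proof (induction k)
  case (Suc k)
  note s = U_alg_hom_simps[OF comult_iter_hom[of k]]
  have "comult (U_gen g) = pure [U_gen g, U_gen gen_P] + pure [1, U_gen g]"
    using assms by (auto simp: comult_U_gen comult_gen_def)
  then show ?case
    by (simp add: id_tensor_simps[OF s(3,5)] comult_iter_P Suc pure_tensor_pure tensor_sum
        sum.atMost_Suc_shift del: sum.atMost_Suc)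
qed simp

section \<open>Super-commuting copies of \<open>osp(1|2)\<close>\<close>

text \<open>Pure tensors given by functions on the places \<open>1..n\<close> multiply pointwise,
  and exchanging factors becomes composition with a transposition.\<close>

definition pure_fun :: "nat \<Rightarrow> (nat \<Rightarrow> osp_U) \<Rightarrow> tens" where
  "pure_fun n w = pure (map w [1..<Suc n])"

definition parity :: "nat \<Rightarrow> nat set \<Rightarrow> tens" where
  "parity n A = pure_fun n (\<lambda>j. if j \<in> A then U_gen gen_P else 1)"

text \<open>
  With \<open>P\<close> in all later tensor factors, whether or not they belong to a given set \<open>A\<close>, the
  elements at different places anticommute for odd \<open>x\<close>, and \<open>R_check_conj\<close> just permutes the places.
\<close>

definition odd_at :: "nat \<Rightarrow> osp_U \<Rightarrow> nat \<Rightarrow> tens" where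
  "odd_at n x i = pure_fun n (\<lambda>j. if j = i then x else if i < j then U_gen gen_P else 1)"

definition odd_sum :: "nat \<Rightarrow> osp_U \<Rightarrow> nat set \<Rightarrow> tens" where
  "odd_sum n x A = (\<Sum>i\<in>A. odd_at n x i)"

definition super_casimir :: "nat \<Rightarrow> nat set \<Rightarrow> tens" where
  "super_casimir n A = 8 *\<^sub>C ((odd_sum n (U_gen gen_Fp) A * odd_sum n (U_gen gen_Fm) A
     - odd_sum n (U_gen gen_Fm) A * odd_sum n (U_gen gen_Fp) A) * parity n A) + parity n A"

lemma pure_fun_cong: "(\<And>j. 1 \<le> j \<Longrightarrow> j \<le> n \<Longrightarrow> v j = w j) \<Longrightarrow> pure_fun n v = pure_fun n w"
  unfolding pure_fun_def by (rule arg_cong[where f = pure]) auto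

lemma pure_fun_mult: "pure_fun n v * pure_fun n w = pure_fun n (\<lambda>j. v j * w j)"
  by (simp add: pure_fun_def pure_times_pure map2_map_map)

lemma pure_fun_in_tens_deg: "pure_fun n w \<in> tens_deg n"
  by (simp add: pure_fun_def pure_in_tens_deg)

lemma pure_fun_upd:
  assumes "1 \<le> i" "i \<le> n"
  shows "pure_fun n (w(i := a + b)) = pure_fun n (w(i := a)) + pure_fun n (w(i := b))"
    and "pure_fun n (w(i := c *\<^sub>C a)) = c *\<^sub>C pure_fun n (w(i := a))"
    and "pure_fun n (w(i := - a)) = - pure_fun n (w(i := a))"
proof -
  have "[1..<Suc n] = [1..<i] @ i # [Suc i..<Suc n]"
    using assms upt_add_eq_append[of 1 i "Suc n - i"] by (simp add: upt_conv_Cons del: upt_Suc)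
  then have "map (w(i := x)) [1..<Suc n] = map w [1..<i] @ x # map w [Suc i..<Suc n]" for x
    by (auto simp del: upt_Suc)
  note e = this
  show "pure_fun n (w(i := a + b)) = pure_fun n (w(i := a)) + pure_fun n (w(i := b))"
    "pure_fun n (w(i := c *\<^sub>C a)) = c *\<^sub>C pure_fun n (w(i := a))"
    "pure_fun n (w(i := - a)) = - pure_fun n (w(i := a))"
    unfolding pure_fun_def e by (simp_all only: pure_linear)
qed

lemma pure_fun_neg:
  assumes "1 \<le> i" "i \<le> n" "v i = - w i" "\<And>j. 1 \<le> j \<Longrightarrow> j \<le> n \<Longrightarrow> j \<noteq> i \<Longrightarrow> v j = w j"
  shows "pure_fun n v = - pure_fun n w"
proof -
  have "pure_fun n v = pure_fun n (w(i := - w i))"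
    by (rule pure_fun_cong) (use assms in auto)
  then show ?thesis by (simp add: pure_fun_upd(3)[OF assms(1,2)])
qed

lemma parity_empty: "parity n {} = tens_one n"
  by (simp add: parity_def pure_fun_def map_replicate_const del: upt_Suc)

lemma parity_mult: "parity n A * parity n B = parity n ((A - B) \<union> (B - A))"
  unfolding parity_def pure_fun_mult by (rule pure_fun_cong) (auto simp: U_P_square)

lemma parity_in_tens_deg: "parity n A \<in> tens_deg n"
  by (simp add: parity_def pure_fun_in_tens_deg)

lemma odd_at_in_tens_deg: "odd_at n x i \<in> tens_deg n"
  by (simp add: odd_at_def pure_fun_in_tens_deg)

lemma odd_sum_in_tens_deg: "odd_sum n x A \<in> tens_deg n"
  unfolding odd_sum_def by (intro cvs.span_sum odd_at_in_tens_deg)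

lemma parity_odd_at:
  assumes x: "U_gen gen_P * x = - (x * U_gen gen_P)" and i: "1 \<le> i" "i \<le> n"
  shows "parity n A * odd_at n x i = (if i \<in> A then - (odd_at n x i * parity n A) else odd_at n x i * parity n A)"
proof (cases "i \<in> A")
  case True
  then have "parity n A * odd_at n x i = - (odd_at n x i * parity n A)"
    unfolding parity_def odd_at_def pure_fun_mult by (intro pure_fun_neg[OF i]) (auto simp: x True)
  then show ?thesis using True by simp
next
  case False
  then have "parity n A * odd_at n x i = odd_at n x i * parity n A"
    unfolding parity_def odd_at_def pure_fun_mult by (intro pure_fun_cong) (auto simp: i x)
  then show ?thesis using False by simp
qed

text \<open>The two orders differ only at the later of the places \<open>i\<close> and
  \<open>j\<close>, where a \<open>P\<close> meets an odd entry.\<close>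

lemma odd_at_anticommute:
  assumes x: "U_gen gen_P * x = - (x * U_gen gen_P)" and y: "U_gen gen_P * y = - (y * U_gen gen_P)"
    and i: "1 \<le> i" "i \<le> n" and j: "1 \<le> j" "j \<le> n" and "i \<noteq> j"
  shows "odd_at n x i * odd_at n y j = - (odd_at n y j * odd_at n x i)"
proof (cases "i < j")
  case True
  then show ?thesis
    unfolding odd_at_def pure_fun_mult by (intro pure_fun_neg[of j]) (auto simp: y j)
next
  case False
  then show ?thesis
    unfolding odd_at_def pure_fun_mult using \<open>i \<noteq> j\<close> by (intro pure_fun_neg[of i]) (auto simp: x i)
qed

text \<open>Three factors leave exactly one \<open>P\<close> at each later place, whereas two would
  leave none. This is why cubic relations can be transferred from \<open>U\<close> to a single
  place.\<close>

lemma odd_at_mult3: "odd_at n x i * odd_at n y i * odd_at n z i = odd_at n (x * y * z) i"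
  unfolding odd_at_def pure_fun_mult by (intro pure_fun_cong) (auto simp: U_P_square)

lemma odd_at_linear:
  assumes "1 \<le> i" "i \<le> n"
  shows "odd_at n (a + b) i = odd_at n a i + odd_at n b i" "odd_at n (c *\<^sub>C a) i = c *\<^sub>C odd_at n a i"
    "odd_at n (- a) i = - odd_at n a i"
proof -
  have "odd_at n a i = pure_fun n ((\<lambda>j. if i < j then U_gen gen_P else 1)(i := a))" for a
    unfolding odd_at_def by (rule pure_fun_cong) auto
  then show "odd_at n (a + b) i = odd_at n a i + odd_at n b i" "odd_at n (c *\<^sub>C a) i = c *\<^sub>C odd_at n a i"
    "odd_at n (- a) i = - odd_at n a i"
    using pure_fun_upd[OF assms] by simp_all
qed


section \<open>The action of adjacent transpositions\<close>

lemma pure_list_update: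
  assumes "p < length w"
  shows "pure (w[p := a + b]) = pure (w[p := a]) + pure (w[p := b])"
    "pure (w[p := c *\<^sub>C a]) = c *\<^sub>C pure (w[p := a])"
  using assms by (simp_all add: upd_conv_take_nth_drop pure_linear)

lemma swap_factors_simps:
  "swap_factors i (s + t) = swap_factors i s + swap_factors i t"
  "swap_factors i (c *\<^sub>C t) = c *\<^sub>C swap_factors i t"
  "swap_factors i (pure w) =
    pure (if 1 \<le> i \<and> i < length w then w[i - 1 := w ! i, i := w ! (i - 1)] else w)"
proof -
  define sw where "sw w = (if 1 \<le> i \<and> i < length w then w[i - 1 := w ! i, i := w ! (i - 1)] else w)"
    for w :: "osp_U list"
  \<comment> \<open>\<open>q\<close> is the image of \<open>p\<close> under the exchange of the list
    positions \<open>i - 1\<close> and \<open>i\<close>, which hold the factors \<open>i\<close> and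
    \<open>i + 1\<close>.\<close>
  have upd: "\<exists>q < length w. \<forall>a. sw (w[p := a]) = (sw w)[q := a]" if "p < length w" for w p
  proof (cases "1 \<le> i \<and> i < length w")
    case True
    then obtain m where m: "i = Suc m" "Suc m < length w" by (cases i) auto
    consider "p = m" | "p = Suc m" | "p \<noteq> m" "p \<noteq> Suc m" by blast
    then show ?thesis
    proof cases
      case 1
      then have "sw (w[p := a]) = (sw w)[Suc m := a]" for a
        using m by (simp add: sw_def)
      then show ?thesis using m by blast
    next
      case 2
      then have "sw (w[p := a]) = (sw w)[m := a]" for a
        using m by (simp add: sw_def list_update_swap[of m "Suc m"])
      then show ?thesis using m by (intro exI[of _ m]) simp
    next
      case 3
      then have "sw (w[p := a]) = (sw w)[p := a]" for a
        using m by (simp add: sw_def list_update_swap[of p])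
      then show ?thesis using that by blast
    qed
  qed (use that in \<open>auto simp: sw_def\<close>)
  have "pure (sw (xs @ [a + b] @ ys)) = pure (sw (xs @ [a] @ ys)) + pure (sw (xs @ [b] @ ys)) \<and>
      pure (sw (xs @ [c *\<^sub>C a] @ ys)) = c *\<^sub>C pure (sw (xs @ [a] @ ys))" for xs ys a b c
  proof -
    let ?w = "xs @ [0] @ ys"
    obtain q where q: "q < length ?w" "\<And>a. sw (?w[length xs := a]) = (sw ?w)[q := a]"
      using upd[of "length xs" ?w] by auto
    define W where "W = sw ?w"
    have "q < length W" using q(1) by (simp add: W_def sw_def)
    moreover have "sw (xs @ [a] @ ys) = W[q := a]" for a
      using q(2)[of a] by (simp add: W_def)
    ultimately show ?thesis
      by (simp only: pure_list_update)
  qed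
  then have "multilinear (\<lambda>w. pure (sw w))"
    unfolding multilinear_def by blast
  note s = tensor_lift_simps[OF this]
  show "swap_factors i (s + t) = swap_factors i s + swap_factors i t"
    "swap_factors i (c *\<^sub>C t) = c *\<^sub>C swap_factors i t"
    "swap_factors i (pure w) =
      pure (if 1 \<le> i \<and> i < length w then w[i - 1 := w ! i, i := w ! (i - 1)] else w)"
    unfolding swap_factors_def by (fact s[unfolded sw_def])+
qed

lemma swap_factors_mult:
  assumes s: "s \<in> tens_deg n" and t: "t \<in> tens_deg n"
  shows "swap_factors i (s * t) = swap_factors i s * swap_factors i t"
proof (rule linear_eq_on_span[where L = "\<lambda>s. swap_factors i (s * t)"
      and M = "\<lambda>s. swap_factors i s * swap_factors i t", OF _ _ _ _ _ s])
  fix s assume s: "s \<in> pure ` {w. length w = n}"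
  show "swap_factors i (s * t) = swap_factors i s * swap_factors i t"
  proof (rule linear_eq_on_span[where L = "\<lambda>t. swap_factors i (s * t)"
        and M = "\<lambda>t. swap_factors i s * swap_factors i t", OF _ _ _ _ _ t])
    fix t assume "t \<in> pure ` {w. length w = n}"
    then obtain v w where vw: "s = pure v" "t = pure w" "length v = n" "length w = n" using s by blast
    show "swap_factors i (s * t) = swap_factors i s * swap_factors i t"
      unfolding vw pure_times_pure[OF vw(3)[folded vw(4)]] swap_factors_simps
      by (subst pure_times_pure)
        (use vw(3,4) in \<open>auto intro!: arg_cong[where f = pure] nth_equalityI simp: nth_list_update\<close>)
  qed (simp_all add: swap_factors_simps distrib_left mult_scaleC_right)
qed (simp_all add: swap_factors_simps distrib_right mult_scaleC_left)

lemma swap_factors_closed: "t \<in> tens_deg n \<Longrightarrow> swap_factors i t \<in> tens_deg n"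
  by (rule linear_closed_on_span[of "swap_factors i"])
    (auto simp: swap_factors_simps intro!: pure_in_tens_deg)

lemma swap_factors_pure_fun:
  assumes "1 \<le> i" "i < n"
  shows "swap_factors i (pure_fun n w) = pure_fun n (w \<circ> transpose i (i + 1))"
  unfolding pure_fun_def swap_factors_simps using assms
  by (auto intro!: arg_cong[where f = pure] nth_equalityI simp: nth_list_update transpose_def simp del: upt_Suc)

lemma R_adjacent_parity:
  assumes "1 \<le> i" "i < n"
  shows "R_adjacent n i =
    (1/2) *\<^sub>C (parity n {} + parity n {i} + parity n {i + 1} - parity n {i, i + 1})"
proof -
  have e: "replicate (i - 1) 1 @ [a, b] @ replicate (n - i - 1) 1 =
      map (\<lambda>j. if j = i then a else if j = i + 1 then b else 1) [1..<Suc n]" for a b :: osp_U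
    using assms by (auto intro!: nth_equalityI simp: nth_append nth_Cons' simp del: upt_Suc)
  have p: "pure (replicate (i - 1) 1 @ [a, b] @ replicate (n - i - 1) 1) =
      pure_fun n (\<lambda>j. if j = i then a else if j = i + 1 then b else 1)" for a b
    unfolding pure_fun_def e ..
  have minus: "s \<boxtimes> (t - u) = s \<boxtimes> t - s \<boxtimes> u" "(t - u) \<boxtimes> s = t \<boxtimes> s - u \<boxtimes> s" for s t u
    using tensor_linear(2)[of s "t - u" u] tensor_linear(1)[of "t - u" u s] by simp_all
  have "parity n {} = pure_fun n (\<lambda>j. if j = i then 1 else if j = i + 1 then 1 else 1)"
    "parity n {i} = pure_fun n (\<lambda>j. if j = i then U_gen gen_P else if j = i + 1 then 1 else 1)"
    "parity n {i + 1} = pure_fun n (\<lambda>j. if j = i then 1 else if j = i + 1 then U_gen gen_P else 1)"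
    "parity n {i, i + 1} = pure_fun n (\<lambda>j. if j = i then U_gen gen_P else if j = i + 1 then U_gen gen_P else 1)"
    unfolding parity_def by (rule pure_fun_cong; simp)+
  then show ?thesis
    unfolding R_adjacent_def R_matrix_def Let_def
    by (simp add: tensor_linear minus pure_tensor_pure flip: p)
qed

text \<open>In the square of the R-matrix the mixed terms cancel, and four copies of the unit with
  coefficient 1/4 remain.\<close>

lemma quarter_sum:
  "(1/4) *\<^sub>C x + ((1/4) *\<^sub>C x + ((1/4) *\<^sub>C x + (1/4) *\<^sub>C x)) = x" for x :: "'a::complex_vector"
  unfolding scaleC_add_left[symmetric] by (simp add: scaleC_one)

lemma R_adjacent_square:
  assumes "1 \<le> i" "i < n"
  shows "R_adjacent n i * R_adjacent n i = tens_one n"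
proof -
  have d: "({i, i + 1} - {i}) \<union> ({i} - {i, i + 1}) = {i + 1}" "({i} - {i, i + 1}) \<union> ({i, i + 1} - {i}) = {i + 1}"
    "({i, i + 1} - {i + 1}) \<union> ({i + 1} - {i, i + 1}) = {i}" "({i + 1} - {i, i + 1}) \<union> ({i, i + 1} - {i + 1}) = {i}"
    "({i} - {i + 1}) \<union> ({i + 1} - {i}) = {i, i + 1}" "({i + 1} - {i}) \<union> ({i} - {i + 1}) = {i, i + 1}"
    by auto
  show ?thesis
    unfolding R_adjacent_parity[OF assms] mult_scaleC_left mult_scaleC_right
      distrib_left distrib_right left_diff_distrib right_diff_distrib parity_mult d
    by (simp add: quarter_sum parity_empty algebra_simps)
qed

lemma R_check_conj_linear:
  "R_check_conj n i (s + t) = R_check_conj n i s + R_check_conj n i t"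
  "R_check_conj n i (c *\<^sub>C t) = c *\<^sub>C R_check_conj n i t"
  by (simp_all add: R_check_conj_def swap_factors_simps distrib_left distrib_right
      mult_scaleC_left mult_scaleC_right)

lemma R_check_conj_diff: "R_check_conj n i (s - t) = R_check_conj n i s - R_check_conj n i t"
  using R_check_conj_linear(1)[of n i "s - t" t] by simp

lemma R_check_conj_sum: "R_check_conj n i (sum f A) = (\<Sum>a\<in>A. R_check_conj n i (f a))"
proof -
  have "R_check_conj n i 0 = 0" using R_check_conj_linear(1)[of n i 0 0] by simp
  then show ?thesis
    by (induction A rule: infinite_finite_induct) (simp_all add: R_check_conj_linear)
qed

lemma R_check_conj_mult:
  assumes i: "1 \<le> i" "i < n" and st: "s \<in> tens_deg n" "t \<in> tens_deg n"
  shows "R_check_conj n i (s * t) = R_check_conj n i s * R_check_conj n i t"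
proof -
  let ?R = "R_adjacent n i"
  have "R_check_conj n i s * R_check_conj n i t =
      ?R * swap_factors i s * ((?R * ?R) * swap_factors i t) * ?R"
    by (simp add: R_check_conj_def mult.assoc)
  then show ?thesis
    by (simp add: R_adjacent_square[OF i] tens_one_left swap_factors_closed st R_check_conj_def
        swap_factors_mult[OF st] mult.assoc)
qed

text \<open>As the R-matrix is its own inverse, computing a conjugate amounts to moving the R-matrix
  from one side to the other.\<close>

lemma R_check_conj_eqI:
  assumes i: "1 \<le> i" "i < n" and t: "t \<in> tens_deg n"
    and eq: "R_adjacent n i * swap_factors i s = t * R_adjacent n i"
  shows "R_check_conj n i s = t"
  by (simp add: R_check_conj_def eq mult.assoc R_adjacent_square[OF i] tens_one_right t)

lemma R_check_conj_parity:
  assumes i: "1 \<le> i" "i < n"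
  shows "R_check_conj n i (parity n A) = parity n (transpose i (i + 1) ` A)"
proof (rule R_check_conj_eqI[OF i parity_in_tens_deg])
  have s: "swap_factors i (parity n A) = parity n (transpose i (i + 1) ` A)"
    unfolding parity_def swap_factors_pure_fun[OF i]
    by (rule pure_fun_cong) (auto simp: in_transpose_image_iff)
  define Q where "Q = parity n (transpose i (i + 1) ` A)"
  have comm: "parity n B * Q = Q * parity n B" for B
    by (simp add: Q_def parity_mult Un_commute)
  show "R_adjacent n i * swap_factors i (parity n A) = parity n (transpose i (i + 1) ` A) * R_adjacent n i"
    unfolding s R_adjacent_parity[OF i] Q_def[symmetric]
    by (simp add: mult_scaleC_left mult_scaleC_right distrib_left distrib_right left_diff_distrib
        right_diff_distrib comm)
qed

text \<open>Moving the R-matrix past an odd element at one of its two places produces a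
  \<open>P\<close> at the other place. It compensates the \<open>P\<close> that the exchange of
  factors adds at place \<open>i\<close> (if \<open>j = i\<close>) or removes from place
  \<open>i + 1\<close> (if \<open>j = i + 1\<close>). For other \<open>j\<close> the exchange
  changes nothing and the R-matrix commutes.\<close>

lemma R_check_conj_odd_at:
  assumes x: "U_gen gen_P * x = - (x * U_gen gen_P)" and i: "1 \<le> i" "i < n" and j: "1 \<le> j" "j \<le> n"
  shows "R_check_conj n i (odd_at n x j) = odd_at n x (transpose i (i + 1) j)"
proof (rule R_check_conj_eqI[OF i odd_at_in_tens_deg])
  let ?R = "R_adjacent n i"
  note R = R_adjacent_parity[OF i]
  note lin = mult_scaleC_left mult_scaleC_right distrib_left distrib_right left_diff_distrib right_diff_distrib
  consider "j = i" | "j = i + 1" | "j \<noteq> i" "j \<noteq> i + 1" by blast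
  then show "?R * swap_factors i (odd_at n x j) = odd_at n x (transpose i (i + 1) j) * ?R"
  proof cases
    case 1
    let ?h = "odd_at n x (i + 1)"
    have s: "swap_factors i (odd_at n x j) = ?h * parity n {i}"
      unfolding odd_at_def swap_factors_pure_fun[OF i] parity_def pure_fun_mult
      by (rule pure_fun_cong) (auto simp: 1 transpose_def)
    have p: "parity n A * (?h * parity n {i}) = (if i + 1 \<in> A then - (?h * (parity n A * parity n {i}))
        else ?h * (parity n A * parity n {i}))" for A
      using parity_odd_at[OF x, of "i + 1" n A] i by (auto simp flip: mult.assoc)
    have d: "({i, i + 1} - {i}) \<union> ({i} - {i, i + 1}) = {i + 1}"
      "({i + 1} - {i}) \<union> ({i} - {i + 1}) = {i, i + 1}" by auto
    show ?thesis
      unfolding s R lin p parity_mult d using 1 i by (simp add: algebra_simps)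
  next
    case 2
    let ?h = "odd_at n x i"
    have s: "swap_factors i (odd_at n x j) = ?h * parity n {i + 1}"
      unfolding odd_at_def swap_factors_pure_fun[OF i] parity_def pure_fun_mult
      by (rule pure_fun_cong) (auto simp: 2 transpose_def U_P_square)
    have p: "parity n A * (?h * parity n {i + 1}) = (if i \<in> A then - (?h * (parity n A * parity n {i + 1}))
        else ?h * (parity n A * parity n {i + 1}))" for A
      using parity_odd_at[OF x, of i n A] i by (auto simp flip: mult.assoc)
    have d: "({i, i + 1} - {i + 1}) \<union> ({i + 1} - {i, i + 1}) = {i}"
      "({i} - {i + 1}) \<union> ({i + 1} - {i}) = {i, i + 1}" by auto
    show ?thesis
      unfolding s R lin p parity_mult d using 2 i by (simp add: algebra_simps)
  next
    case 3
    have s: "swap_factors i (odd_at n x j) = odd_at n x j"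
      unfolding odd_at_def swap_factors_pure_fun[OF i]
      by (rule pure_fun_cong) (use 3 in \<open>auto simp: transpose_def\<close>)
    show ?thesis
      unfolding s R lin using 3 j by (simp add: parity_odd_at[OF x])
  qed
qed

lemma P_F_anticommute: "g \<in> {gen_Fp, gen_Fm} \<Longrightarrow> U_gen gen_P * U_gen g = - (U_gen g * U_gen gen_P)"
  using U_relations by auto

lemma R_check_conj_super_casimir:
  assumes i: "1 \<le> i" "i < n" and A: "A \<subseteq> {1..n}"
  shows "R_check_conj n i (super_casimir n A) = super_casimir n (transpose i (i + 1) ` A)"
proof -
  have s: "R_check_conj n i (odd_sum n (U_gen g) A) = odd_sum n (U_gen g) (transpose i (i + 1) ` A)"
    if "g \<in> {gen_Fp, gen_Fm}" for g
  proof -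
    have "R_check_conj n i (odd_sum n (U_gen g) A) =
        (\<Sum>j\<in>A. odd_at n (U_gen g) (transpose i (i + 1) j))"
      unfolding odd_sum_def R_check_conj_sum
      by (intro sum.cong refl R_check_conj_odd_at[OF P_F_anticommute[OF that] i]) (use A in auto)
    then show ?thesis
      by (simp add: odd_sum_def sum.reindex)
  qed
  show ?thesis
    unfolding super_casimir_def
    by (simp add: R_check_conj_linear R_check_conj_diff R_check_conj_mult[OF i] s R_check_conj_parity[OF i]
        odd_sum_in_tens_deg parity_in_tens_deg tens_deg_mult cvs.span_diff)
qed

section \<open>The Bannai--Ito relation for three super-commuting copies\<close>

text \<open>
  Here \<open>x\<close> stands for \<open>8 F\<^sup>+\<close> and \<open>y\<close> for \<open>F\<^sup>-\<close>, so that all coefficients are integers and the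
  computation takes place in a ring without unit; \<open>e\<close> is the unit of a tensor power.
\<close>

definition cubic :: "'a::ring \<Rightarrow> 'a \<Rightarrow> bool" where
  "cubic x y \<longleftrightarrow> x * x * y - y * x * x = - (x + x) \<and> y * y * x - x * y * y = y + y"

text \<open>The equation is oriented as a rewrite rule moving the second argument to the
  right.\<close>

definition anti :: "'a::ring \<Rightarrow> 'a \<Rightarrow> bool" where
  "anti x y \<longleftrightarrow> y * x = - (x * y)"

definition casimir_of :: "'a::ring \<Rightarrow> 'a \<Rightarrow> 'a \<Rightarrow> 'a" where
  "casimir_of x y p = (x * y - y * x) * p + p"

text \<open>Normal forms are right-nested products, so each commutation rule is also needed in front
  of a tail \<open>z\<close>.\<close>

lemma assoc_rules:
  fixes a b :: "'a::ring"
  shows "b * a = a * b \<Longrightarrow> b * (a * z) = a * (b * z)" "b * a = - (a * b) \<Longrightarrow> b * (a * z) = - (a * (b * z))"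
    "e * a = a \<Longrightarrow> e * (a * z) = a * z" "a * e = a \<Longrightarrow> a * (e * z) = a * z"
  by (simp_all flip: mult.assoc)

text \<open>By anticommutation the square of a sum is the sum of the squares, and the square of an
  element of one copy commutes with the other copy; all mixed terms vanish.\<close>

lemma cubic_add:
  fixes x1 :: "'a::ring"
  assumes c: "cubic x1 y1" "cubic x2 y2"
    and a: "anti x1 x2" "anti x1 y2" "anti y1 x2" "anti y1 y2"
  shows "cubic (x1 + x2) (y1 + y2)"
proof -
  note a' = a[unfolded anti_def]
  note r = a' a'[THEN assoc_rules(2)]
  have q: "x1 * (x1 * y1) = y1 * (x1 * x1) - (x1 + x1)" "x2 * (x2 * y2) = y2 * (x2 * x2) - (x2 + x2)"
    "y1 * (y1 * x1) = x1 * (y1 * y1) + (y1 + y1)" "y2 * (y2 * x2) = x2 * (y2 * y2) + (y2 + y2)"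
    using c unfolding cubic_def by (auto simp: algebra_simps)
  show ?thesis
    unfolding cubic_def by (simp add: algebra_simps r q)
qed

text \<open>Commuting \<open>x\<close> past \<open>(x * y - y * x) * p\<close> leaves
  \<open>(x * x * y - y * x * x) * p\<close>, and past the summand \<open>p\<close> it leaves
  \<open>x * p + x * p\<close>; the constant in \<open>cubic\<close> makes these cancel. The
  argument for \<open>y\<close> is the same.\<close>

lemma casimir_of_central:
  assumes "cubic x y" and p: "anti x p" "anti y p" "p * p = e" and e: "e * x = x" "x * e = x" "e * y = y" "y * e = y"
  shows "x * casimir_of x y p = casimir_of x y p * x" "y * casimir_of x y p = casimir_of x y p * y"
    "p * casimir_of x y p = casimir_of x y p * p"
proof -
  note a' = p(1,2)[unfolded anti_def]
  note r = a' a'[THEN assoc_rules(2)]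
  have "x * (x * y) = y * (x * x) - (x + x)" "y * (y * x) = x * (y * y) + (y + y)"
    using assms(1) unfolding cubic_def by (auto simp: algebra_simps)
  then have "x * (x * (y * p)) = y * (x * (x * p)) - (x * p + x * p)"
    "y * (y * (x * p)) = x * (y * (y * p)) + (y * p + y * p)"
    by (metis (no_types, lifting) mult.assoc left_diff_distrib distrib_right)+
  then show "x * casimir_of x y p = casimir_of x y p * x" "y * casimir_of x y p = casimir_of x y p * y"
    "p * casimir_of x y p = casimir_of x y p * p"
    unfolding casimir_of_def by (simp_all add: algebra_simps r)
qed

locale three_copies =
  fixes x y p :: "nat \<Rightarrow> 'a::ring" and e :: 'a
  assumes cubic: "cubic (x i) (y i)"
    and unit: "e * x i = x i" "x i * e = x i" "e * y i = y i" "y i * e = y i" "e * p i = p i" "p i * e = p i"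
    and p_own: "anti (x i) (p i)" "anti (y i) (p i)" "p i * p i = e"
    and p_other: "i \<noteq> j \<Longrightarrow> p i * x j = x j * p i" "i \<noteq> j \<Longrightarrow> p i * y j = y j * p i" "p i * p j = p j * p i"
    and xy_other: "i \<noteq> j \<Longrightarrow> anti (x i) (x j)" "i \<noteq> j \<Longrightarrow> anti (x i) (y j)" "i \<noteq> j \<Longrightarrow> anti (y i) (y j)"
begin

lemmas unit_rules = unit unit(1,3,5)[THEN assoc_rules(3)] unit(2,4,6)[THEN assoc_rules(4)]

definition c :: "nat \<Rightarrow> 'a" where
  "c i = casimir_of (x i) (y i) (p i)"

definition c2 :: "nat \<Rightarrow> nat \<Rightarrow> 'a" where
  "c2 i j = casimir_of (x i + x j) (y i + y j) (p i * p j)"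

definition c3 :: "nat \<Rightarrow> nat \<Rightarrow> nat \<Rightarrow> 'a" where
  "c3 i j k = casimir_of (x i + x j + x k) (y i + y j + y k) (p i * p j * p k)"

text \<open>Since \<open>p i * p i = e\<close>, multiplying \<open>c i\<close> by \<open>p i\<close>
  exposes the commutator. The result serves as a normal ordering rule that trades
  \<open>y i * x i\<close> for the central \<open>c i\<close>.\<close>

lemma yx: "y i * x i = x i * y i - c i * p i + e"
  unfolding c_def casimir_of_def
  by (simp add: algebra_simps p_own unit)

lemma yx_assoc: "y i * (x i * z) = x i * (y i * z) - c i * (p i * z) + e * z"
  using arg_cong[OF yx[of i], of "\<lambda>t. t * z"] by (simp add: algebra_simps)

text \<open>For \<open>i \<noteq> j\<close> an odd element of copy \<open>j\<close> passes two odd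
  factors of \<open>c i\<close>, so the signs cancel; for \<open>i = j\<close> this is the
  centrality of the Casimir element.\<close>

lemma c_commute: "x j * c i = c i * x j" "y j * c i = c i * y j" "p j * c i = c i * p j" "c j * c i = c i * c j"
proof -
  show x: "x j * c i = c i * x j" for i j
  proof (cases "i = j")
    case True
    then show ?thesis using casimir_of_central(1)[OF cubic p_own unit(1-4)] by (simp add: c_def)
  next
    case False
    note r = p_other(1)[OF False] xy_other(1)[OF False[symmetric], unfolded anti_def]
      xy_other(2)[OF False[symmetric], unfolded anti_def]
    show ?thesis
      unfolding c_def casimir_of_def
      by (simp add: algebra_simps r r(1)[THEN assoc_rules(1)] r(2-)[THEN assoc_rules(2)])
  qed
  show y: "y j * c i = c i * y j" for i j
  proof (cases "i = j")
    case True
    then show ?thesis using casimir_of_central(2)[OF cubic p_own unit(1-4)] by (simp add: c_def)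
  next
    case False
    note r = p_other(2)[OF False] xy_other(2,3)[OF False, unfolded anti_def]
    show ?thesis
      unfolding c_def casimir_of_def
      by (simp add: algebra_simps r r(1)[THEN assoc_rules(1)] r(2-)[THEN assoc_rules(2)])
  qed
  show p: "p j * c i = c i * p j" for i j
  proof (cases "i = j")
    case True
    then show ?thesis using casimir_of_central(3)[OF cubic p_own unit(1-4)] by (simp add: c_def)
  next
    case False
    note r = p_other(1)[OF False[symmetric]] p_other(2)[OF False[symmetric]] p_other(3)[of j i]
    show ?thesis
      unfolding c_def casimir_of_def
      by (simp add: algebra_simps r r[THEN assoc_rules(1)])
  qed
  show "c j * c i = c i * c j"
    unfolding c_def[of j] casimir_of_def
    by (simp add: algebra_simps x y p x[THEN assoc_rules(1)] y[THEN assoc_rules(1)])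
qed

lemma c_unit: "e * c i = c i" "c i * e = c i"
  unfolding c_def casimir_of_def by (simp_all add: algebra_simps unit_rules)

text \<open>The coupling part of the pair Casimir: the cross terms of the commutator of
  \<open>x i + x j\<close> and \<open>y i + y j\<close>, collected by anticommutation. They occur
  twice, written as a sum because the ring has no unit.\<close>

definition d :: "nat \<Rightarrow> nat \<Rightarrow> 'a" where
  "d i j = x i * y j + x i * y j - y i * x j - y i * x j"

lemma c2_eq: "i \<noteq> j \<Longrightarrow> c2 i j = c i * p j + c j * p i - p i * p j + d i j * p i * p j"
proof -
  assume ij: "i \<noteq> j"
  have cp: "c k * p k = x k * y k - y k * x k + e" for k using yx[of k] by simp
  \<comment> \<open>Multiplying \<open>cp\<close> by \<open>p k\<close> on the right recovers
    \<open>c k\<close>.\<close>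
  have z: "c k = (x k * y k - y k * x k + e) * p k" for k
    unfolding cp[symmetric] mult.assoc p_own(3) c_unit ..
  have r: "y j * x i = - (x i * y j)" "x j * y i = - (y i * x j)"
    using xy_other(2)[OF ij] xy_other(2)[OF ij[symmetric]] by (simp_all add: anti_def)
  have "c2 i j = (x i * y i - y i * x i + e) * (p i * p j) + (x j * y j - y j * x j + e) * (p i * p j)
      - e * (p i * p j) - e * (p i * p j) + p i * p j + d i j * (p i * p j)"
    unfolding c2_def casimir_of_def d_def by (simp add: algebra_simps r r[THEN assoc_rules(2)])
  also have "(x i * y i - y i * x i + e) * (p i * p j) = c i * p j"
    using z[of i] by (simp add: mult.assoc)
  also have "(x j * y j - y j * x j + e) * (p i * p j) = c j * p i"
    using z[of j] p_other(3)[of i j] by (simp add: mult.assoc)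
  finally show ?thesis by (simp add: mult.assoc unit_rules)
qed

text \<open>Inclusion-exclusion: up to the common factor \<open>p i * p j * p k\<close>, a Casimir
  is a constant plus terms quadratic in the odd elements, so only single and pair terms
  occur.\<close>

lemma c3_eq: "i \<noteq> j \<Longrightarrow> j \<noteq> k \<Longrightarrow> i \<noteq> k \<Longrightarrow> c3 i j k =
   c2 i j * p k + c2 j k * p i + c2 i k * p j - c i * p j * p k - c j * p i * p k - c k * p i * p j + p i * p j * p k"
proof -
  assume n: "i \<noteq> j" "j \<noteq> k" "i \<noteq> k"
  have pp: "p j * p i = p i * p j" "p k * p i = p i * p k" "p k * p j = p j * p k"
    using p_other(3) by blast+
  have pm: "p j * (p i * z) = p i * (p j * z)" "p k * (p i * z) = p i * (p k * z)" "p k * (p j * z) = p j * (p k * z)" for z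
    using pp[THEN assoc_rules(1)] by blast+
  show ?thesis
    unfolding c_def c2_def c3_def casimir_of_def
    by (simp add: algebra_simps pp pm)
qed

text \<open>The terms with a square of \<open>x j\<close> or \<open>y j\<close> cancel. The others
  combine to the commutator of \<open>y j\<close> and \<open>x j\<close>, which equals
  \<open>e - c j * p j\<close> and is even, so it can be pulled out to the left.\<close>

lemma d_anticommutator:
  assumes n: "i \<noteq> j" "j \<noteq> k" "i \<noteq> k"
  shows "d i j * d j k + d j k * d i j = (e - c j * p j) * d i k + (e - c j * p j) * d i k"
proof -
  have r: "x j * x i = - (x i * x j)" "y j * x i = - (x i * y j)" "y j * y i = - (y i * y j)"
    "x j * y i = - (y i * x j)" if "i \<noteq> j" for i j
    using that xy_other[of i j] xy_other(2)[of j i] by (simp_all add: anti_def)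
  note r' = n[THEN r(1)] n[THEN r(2)] n[THEN r(3)] n[THEN r(4)]
  note q = p_other(1,2)[OF n(1)[symmetric]] p_other(1,2)[OF n(2)]
  note s = c_commute(1,2)[of _ j]
  show ?thesis
    unfolding d_def
    by (simp add: algebra_simps r' r'[THEN assoc_rules(2)] q q[THEN assoc_rules(1)]
        s s[THEN assoc_rules(1)] yx yx_assoc unit_rules c_unit)
qed

text \<open>Copy \<open>j\<close> is the overlap of the two pairs. Moving the \<open>p\<close>'s
  past the other coupling gives one sign, from \<open>p j\<close>, so the product of the coupling
  terms turns into minus the anticommutator of \<open>d i j\<close> and \<open>d j k\<close>. The
  terms in which \<open>p j\<close> or \<open>p j * p k\<close> (or \<open>p i * p j\<close>) meets
  a coupling of the other pair cancel for the same reason.\<close>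

lemma bannai_ito:
  
  assumes n: "i \<noteq> j" "j \<noteq> k" "i \<noteq> k"
  shows "c2 i j * c2 j k + c2 j k * c2 i j =
    (- c2 i k + c i * c k + c j * c3 i j k) + (- c2 i k + c i * c k + c j * c3 i j k)"
proof -
  have d_p_own: "p i * d i j = - (d i j * p i)" "p j * d i j = - (d i j * p j)" if "i \<noteq> j" for i j
  proof -
    note r = p_own(1,2)[unfolded anti_def] p_other(1,2)[OF that] p_other(1,2)[OF that[symmetric]]
    show "p i * d i j = - (d i j * p i)" "p j * d i j = - (d i j * p j)"
      unfolding d_def by (simp_all add: algebra_simps r r(1,2)[THEN assoc_rules(2)] r(3-)[THEN assoc_rules(1)])
  qed
  have d_p_other: "p k * d i j = d i j * p k" if "k \<noteq> i" "k \<noteq> j" for i j k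
  proof -
    note r = p_other(1,2)[OF that(1)] p_other(1,2)[OF that(2)]
    show ?thesis
      unfolding d_def by (simp add: algebra_simps r r[THEN assoc_rules(1)])
  qed
  have d_c: "d i j * c k = c k * d i j" for i j k
    unfolding d_def by (simp add: algebra_simps c_commute c_commute(1,2)[THEN assoc_rules(1)])
  have e_d: "e * d i j = d i j" for i j
    unfolding d_def by (simp add: algebra_simps unit_rules)
  \<comment> \<open>The anticommutator, read as a rule that moves \<open>d i j\<close> to the left
    of \<open>d j k\<close>; \<open>dd'\<close> is the version with a tail.\<close>
  have dd: "d j k * d i j = d i k + d i k - c j * (p j * d i k) - c j * (p j * d i k) - d i j * d j k"
    using d_anticommutator[OF n] by (simp add: algebra_simps e_d)
  have dd': "d j k * (d i j * z) = d i k * z + d i k * z - c j * (p j * (d i k * z)) - c j * (p j * (d i k * z))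
      - d i j * (d j k * z)" for z
    using arg_cong[OF dd, of "\<lambda>t. t * z"] by (simp add: algebra_simps)
  note neg = n[THEN d_p_own(1)] n[THEN d_p_own(2)]
  note pp = p_other(3)[of j i] p_other(3)[of k i] p_other(3)[of k j]
  note cc = c_commute(4)[of j i] c_commute(4)[of k i] c_commute(4)[of k j]
  note pos = d_p_other[OF n(3)[symmetric] n(2)[symmetric]] d_p_other[OF n(1,3)] d_p_other[OF n(1)[symmetric] n(2)]
    d_c c_commute(3) pp cc
  have p_square: "p i * (p i * z) = e * z" for i z
    by (simp add: p_own(3) flip: mult.assoc)
  show ?thesis
    by (simp add: n c2_eq c3_eq algebra_simps neg neg[THEN assoc_rules(2)] pos pos[THEN assoc_rules(1)]
        p_own(3) p_square dd dd' unit_rules c_unit c_unit(1)[THEN assoc_rules(3)] c_unit(2)[THEN assoc_rules(4)] e_d)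
qed

end

section \<open>The intermediate Casimir elements\<close>

lemma word_perm_append: "word_perm (is @ js) = word_perm is \<circ> word_perm js"
  by (induction "is") (simp_all add: word_perm_def comp_assoc)

lemma word_perm_Cons: "word_perm (i # is) = transpose i (i + 1) \<circ> word_perm is"
  by (simp add: word_perm_def)

lemma word_perm_permutes: "set is \<subseteq> {1..<n} \<Longrightarrow> word_perm is permutes {1..n}"
proof (induction "is")
  case (Cons i "is")
  then show ?case
    unfolding word_perm_Cons by (intro permutes_compose permutes_swap_id) auto
qed (simp add: word_perm_def permutes_id)

text \<open>Induction on the distance: conjugating the transposition of \<open>a\<close> and
  \<open>b'\<close> by that of \<open>b'\<close> and \<open>b' + 1\<close> gives the transposition
  of \<open>a\<close> and \<open>b' + 1\<close>.\<close>

lemma transpose_word: "a < b \<Longrightarrow> 1 \<le> a \<Longrightarrow> b \<le> n \<Longrightarrow> \<exists>is. set is \<subseteq> {1..<n} \<and> word_perm is = transpose a b"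
proof (induction "b - a" arbitrary: b rule: less_induct)
  case less
  show ?case
  proof (cases "b = a + 1")
    case True
    then show ?thesis using less.prems by (intro exI[of _ "[a]"]) (auto simp: word_perm_def)
  next
    case False
    then obtain b' where b': "b = Suc b'" "a < b'" using less.prems by (cases b) auto
    then obtain "is" where "set is \<subseteq> {1..<n}" "word_perm is = transpose a b'"
      using less by force
    moreover have "transpose b' (b' + 1) \<circ> (transpose a b' \<circ> transpose b' (b' + 1)) = transpose a b"
      using b' by (auto simp: fun_eq_iff transpose_def)
    moreover have "word_perm [b'] = transpose b' (b' + 1)"
      by (simp add: word_perm_def)
    ultimately have "word_perm ([b'] @ is @ [b']) = transpose a b"
      by (simp only: word_perm_append)
    with \<open>set is \<subseteq> {1..<n}\<close> show ?thesis
      using b' less.prems by (intro exI[of _ "[b'] @ is @ [b']"]) simp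
  qed
qed

lemma permutation_word:
  assumes "s permutes {1..n}"
  shows "\<exists>is. set is \<subseteq> {1..<n} \<and> word_perm is = s"
  using assms finite_atLeastAtMost[of 1 n]
proof (induction rule: permutes_induct[consumes 2, case_names id swap])
  case id
  show ?case by (rule exI[of _ "[]"]) (simp add: word_perm_def)
next
  case (swap a b p)
  then obtain "is" where is': "set is \<subseteq> {1..<n}" "word_perm is = p" by blast
  obtain js where "set js \<subseteq> {1..<n}" "word_perm js = transpose a b"
  proof (cases "a < b")
    case True
    then show ?thesis using transpose_word[of a b n] swap that by auto
  next
    case False
    then show ?thesis using transpose_word[of b a n] swap that by (auto simp: transpose_commute)
  qed
  with is' show ?case
    by (intro exI[of _ "js @ is"]) (simp add: word_perm_append)
qed

lemma foldr_R_check_conj_super_casimir: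
  assumes "A \<subseteq> {1..n}" "set is \<subseteq> {1..<n}"
  shows "foldr (R_check_conj n) is (super_casimir n A) = super_casimir n (word_perm is ` A)"
  using assms(2)
proof (induction "is")
  case (Cons i "is")
  then have "word_perm is ` A \<subseteq> {1..n}"
    using assms(1) permutes_image[OF word_perm_permutes[of "is" n]] by auto
  then show ?case
    using Cons by (simp add: R_check_conj_super_casimir word_perm_Cons image_comp)
qed (simp add: word_perm_def)

text \<open>The definite description is justified because a word acts on a
  \<open>super_casimir\<close> only through its permutation.\<close>

lemma perm_action_super_casimir:
  assumes "A \<subseteq> {1..n}" "s permutes {1..n}"
  shows "perm_action n s (super_casimir n A) = super_casimir n (s ` A)"
  unfolding perm_action_def
proof (rule the_equality)
  show "\<exists>is. set is \<subseteq> {1..<n} \<and> word_perm is = s \<and>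
      super_casimir n (s ` A) = foldr (R_check_conj n) is (super_casimir n A)"
    using permutation_word[OF assms(2)] foldr_R_check_conj_super_casimir[OF assms(1)] by metis
qed (auto simp: foldr_R_check_conj_super_casimir[OF assms(1)])

text \<open>The elements \<open>odd_at\<close> carry \<open>P\<close>'s beyond place
  \<open>l\<close> that the interval Casimir lacks, so each odd sum is \<open>D F * ?Q\<close> with
  \<open>?Q\<close> the parity of the places after \<open>l\<close>. The Casimir is quadratic in
  \<open>F\<close>, and \<open>?Q\<close> commutes with \<open>D F\<close> and squares to the unit,
  so these \<open>P\<close>'s cancel.\<close>

lemma casimir_interval_super_casimir:
  assumes kl: "1 \<le> k" "k \<le> l" "l \<le> n"
  shows "casimir_interval n k l = super_casimir n {k..l}"
proof -
  define m where "m = l - k"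
  define J where "J t = pure (replicate (k - 1) 1) \<boxtimes> t \<boxtimes> pure (replicate (n - l) 1)" for t
  define D where "D x = J (comult_iter m x)" for x
  note s = U_alg_hom_simps[OF comult_iter_hom[of m]]
  have n: "n = (k - 1) + (Suc m + (n - l))" using kl by (simp add: m_def)
  have minus: "a \<boxtimes> (t - u) \<boxtimes> b = a \<boxtimes> t \<boxtimes> b - a \<boxtimes> u \<boxtimes> b" for a b t u
    using tensor_linear(2)[of a "(t - u) \<boxtimes> b" "u \<boxtimes> b"] tensor_linear(1)[of "t - u" u b] by simp
  have J_mult: "J (t * u) = J t * J u" if "t \<in> tens_deg (Suc m)" "u \<in> tens_deg (Suc m)" for t u
  proof -
    let ?a = "tens_one (k - 1)" and ?b = "tens_one (n - l)"
    have ab: "?a \<in> tens_deg (k - 1)" "?b \<in> tens_deg (n - l)"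
      by (simp_all add: pure_in_tens_deg)
    have "(?a \<boxtimes> t \<boxtimes> ?b) * (?a \<boxtimes> u \<boxtimes> ?b) = (?a * ?a) \<boxtimes> ((t \<boxtimes> ?b) * (u \<boxtimes> ?b))"
      by (rule tensor_mult_tensor[OF ab(1) ab(1) tensor_deg[OF that(1) ab(2)] tensor_deg[OF that(2) ab(2)]])
    also have "(t \<boxtimes> ?b) * (u \<boxtimes> ?b) = (t * u) \<boxtimes> (?b * ?b)"
      by (rule tensor_mult_tensor[OF that ab(2) ab(2)])
    finally show ?thesis
      by (simp only: J_def tens_one_left[OF ab(1)] tens_one_left[OF ab(2)])
  qed
  have D: "D (x * y) = D x * D y" "D (x + y) = D x + D y" "D (x - y) = D x - D y" "D (c *\<^sub>C x) = c *\<^sub>C D x" for x y c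
    unfolding D_def s by (simp_all add: J_mult s(1)) (simp_all add: J_def tensor_linear minus)
  let ?Q = "parity n {Suc l..n}"
  let ?g = "\<lambda>x i. pure_fun n (\<lambda>j. if j = i then x else if i < j \<and> j \<le> l then U_gen gen_P else 1)"
  have D_P: "D (U_gen gen_P) = parity n {k..l}"
  proof -
    have "replicate (k - 1) 1 @ replicate (Suc m) (U_gen gen_P) @ replicate (n - l) 1 =
        map (\<lambda>j. if j \<in> {k..l} then U_gen gen_P else 1) [1..<Suc n]"
      using kl by (auto intro!: nth_equalityI simp: nth_append m_def simp del: upt_Suc replicate_Suc)
    then show ?thesis
      by (simp add: D_def J_def comult_iter_P pure_tensor_pure parity_def pure_fun_def del: upt_Suc replicate_Suc)
  qed
  have D_F: "D (U_gen g) = (\<Sum>i\<in>{k..l}. ?g (U_gen g) i)" if g: "g \<in> {gen_Fp, gen_Fm}" for g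
  proof -
    \<comment> \<open>The summation index of \<open>comult_iter_F\<close> starts at 0, so its term
      \<open>i\<close> has \<open>F\<close> at place \<open>k + i\<close>.\<close>
    have "replicate (k - 1) 1 @ (replicate i 1 @ [x] @ replicate (m - i) (U_gen gen_P)) @ replicate (n - l) 1 =
        map (\<lambda>j. if j = k + i then x else if k + i < j \<and> j \<le> l then U_gen gen_P else 1) [1..<Suc n]"
      if "i \<le> m" for i and x :: osp_U
      using kl that
      by (auto intro!: nth_equalityI simp: nth_append nth_Cons' m_def simp del: upt_Suc)
    then have "D (U_gen g) = (\<Sum>i\<le>m. ?g (U_gen g) (k + i))"
      unfolding D_def J_def comult_iter_F[OF g]
      by (auto simp: tensor_sum pure_tensor_pure pure_fun_def simp del: upt_Suc intro!: sum.cong)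
    also have "\<dots> = (\<Sum>i\<in>{k..l}. ?g (U_gen g) i)"
      by (rule sum.reindex_bij_witness[of _ "\<lambda>i. i - k" "\<lambda>i. k + i"]) (use kl in \<open>auto simp: m_def\<close>)
    finally show ?thesis .
  qed
  have g_Q: "odd_at n x i = ?g x i * ?Q" "?Q * ?g x i = ?g x i * ?Q" if "i \<in> {k..l}" for x i
    unfolding odd_at_def parity_def pure_fun_mult by (rule pure_fun_cong; use that in auto)+
  have F: "odd_sum n (U_gen g) {k..l} = D (U_gen g) * ?Q" "?Q * D (U_gen g) = D (U_gen g) * ?Q"
    if "g \<in> {gen_Fp, gen_Fm}" for g
    unfolding odd_sum_def D_F[OF that] sum_distrib_left sum_distrib_right by (rule sum.cong[OF refl]; rule g_Q; assumption)+
  have QQ: "?Q * ?Q = tens_one n" by (simp add: parity_mult parity_empty)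
  have D_closed: "D (U_gen g) \<in> tens_deg n" if "g \<in> {gen_Fp, gen_Fm}" for g
    unfolding D_F[OF that] by (intro cvs.span_sum pure_fun_in_tens_deg)
  have FF: "odd_sum n (U_gen g) {k..l} * odd_sum n (U_gen g') {k..l} = D (U_gen g) * D (U_gen g')"
    if "g \<in> {gen_Fp, gen_Fm}" "g' \<in> {gen_Fp, gen_Fm}" for g g'
  proof -
    have "odd_sum n (U_gen g) {k..l} * odd_sum n (U_gen g') {k..l} =
        D (U_gen g) * (?Q * D (U_gen g')) * ?Q"
      unfolding F(1)[OF that(1)] F(1)[OF that(2)] by (simp add: mult.assoc)
    also have "\<dots> = D (U_gen g) * (D (U_gen g') * (?Q * ?Q))"
      unfolding F(2)[OF that(2)] by (simp add: mult.assoc)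
    finally show ?thesis by (simp add: QQ tens_one_right D_closed[OF that(2)])
  qed
  have "casimir_interval n k l = D casimir"
    by (simp add: casimir_interval_def D_def J_def m_def)
  also have "\<dots> = super_casimir n {k..l}"
    by (simp add: super_casimir_def casimir_def Let_def D FF D_P)
  finally show ?thesis .
qed

lemma permutation_onto_subset:
  assumes A: "A \<subseteq> {1..n}"
  shows "\<exists>s. s permutes {1..n} \<and> s ` {1..card A} = A"
proof -
  let ?K = "{1..card A}"
  have fin: "finite A" using A finite_subset by blast
  have le: "card A \<le> n" using card_mono[OF _ A] by simp
  obtain f where f: "bij_betw f ?K A"
    using finite_same_card_bij[of ?K A] fin by auto
  have "card ({1..n} - ?K) = card ({1..n} - A)"
    using A le fin by (subst (1 2) card_Diff_subset) auto
  then obtain g where g: "bij_betw g ({1..n} - ?K) ({1..n} - A)"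
    using finite_same_card_bij by blast
  define s where "s j = (if j \<in> ?K then f j else if j \<in> {1..n} then g j else j)" for j
  have sK: "bij_betw s ?K A"
    using f by (rule bij_betw_cong[THEN iffD1, rotated]) (simp add: s_def)
  have "bij_betw s ({1..n} - ?K) ({1..n} - A)"
    using g by (rule bij_betw_cong[THEN iffD1, rotated]) (simp add: s_def)
  from bij_betw_combine[OF sK this] have "bij_betw s (?K \<union> ({1..n} - ?K)) (A \<union> ({1..n} - A))" by blast
  moreover have "?K \<union> ({1..n} - ?K) = {1..n}" "A \<union> ({1..n} - A) = {1..n}"
    using A le by auto
  ultimately have "s permutes {1..n}"
    using le by (intro bij_imp_permutes) (auto simp: s_def)
  with sK show ?thesis by (auto simp: bij_betw_def)
qed

lemma super_casimir_empty: "super_casimir n {} = tens_one n"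
  by (simp add: super_casimir_def odd_sum_def parity_empty)

lemma intermediate_casimir_super_casimir:
  assumes A: "A \<subseteq> {1..n}"
  shows "intermediate_casimir n A = super_casimir n A"
proof (cases "A = {}")
  case True
  then show ?thesis
    by (simp add: intermediate_casimir_def super_casimir_empty tensor_power_def)
next
  case False
  have fin: "finite A" using A finite_subset by blast
  have card: "1 \<le> card A" "card A \<le> n"
    using False fin card_mono[OF _ A] by (auto simp: Suc_le_eq card_gt_0_iff)
  have eq: "perm_action n s (casimir_interval n k l) = super_casimir n (s ` {k..l})"
    if "1 \<le> k" "k \<le> l" "l \<le> n" "s permutes {1..n}" for k l s
    using that by (simp add: casimir_interval_super_casimir perm_action_super_casimir)
  obtain s where s: "s permutes {1..n}" "s ` {1..card A} = A"
    using permutation_onto_subset[OF A] by blast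
  have "(THE X. \<exists>k l s. 1 \<le> k \<and> k \<le> l \<and> l \<le> n \<and> card {k..l} = card A \<and>
        s permutes {1..n} \<and> s ` {k..l} = A \<and> X = perm_action n s (casimir_interval n k l)) = super_casimir n A"
  proof (rule the_equality)
    show "\<exists>k l s. 1 \<le> k \<and> k \<le> l \<and> l \<le> n \<and> card {k..l} = card A \<and>
        s permutes {1..n} \<and> s ` {k..l} = A \<and> super_casimir n A = perm_action n s (casimir_interval n k l)"
      by (rule exI[of _ 1], rule exI[of _ "card A"], rule exI[of _ s]) (use s card in \<open>simp add: eq\<close>)
  qed (auto simp: eq)
  then show ?thesis using False by (simp add: intermediate_casimir_def)
qed

section \<open>The Bannai--Ito relations\<close>

lemma odd_sum_union:
  assumes "A \<subseteq> {1..n}" "B \<subseteq> {1..n}" "A \<inter> B = {}"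
  shows "odd_sum n x (A \<union> B) = odd_sum n x A + odd_sum n x B"
proof -
  have "finite A" "finite B" using assms(1,2) by (auto intro: finite_subset)
  then show ?thesis using assms(3) by (simp add: odd_sum_def sum.union_disjoint)
qed

lemma parity_union: "A \<inter> B = {} \<Longrightarrow> parity n (A \<union> B) = parity n A * parity n B"
  unfolding parity_mult by (rule arg_cong[where f = "parity n"]) auto

lemma odd_sum_anticommute:
  assumes x: "U_gen gen_P * x = - (x * U_gen gen_P)" and y: "U_gen gen_P * y = - (y * U_gen gen_P)"
    and AB: "A \<subseteq> {1..n}" "B \<subseteq> {1..n}" "A \<inter> B = {}"
  shows "anti (odd_sum n x A) (odd_sum n y B)"
proof -
  have "odd_sum n y B * odd_sum n x A = (\<Sum>i\<in>A. \<Sum>j\<in>B. odd_at n y j * odd_at n x i)"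
    unfolding odd_sum_def sum_product by (rule sum.swap)
  also have "\<dots> = (\<Sum>i\<in>A. \<Sum>j\<in>B. - (odd_at n x i * odd_at n y j))"
    by (intro sum.cong refl odd_at_anticommute y x) (use AB in auto)
  also have "\<dots> = - (odd_sum n x A * odd_sum n y B)"
    by (simp add: odd_sum_def sum_product sum_negf)
  finally show ?thesis by (simp add: anti_def)
qed

lemma parity_odd_sum_own:
  assumes x: "U_gen gen_P * x = - (x * U_gen gen_P)" and A: "A \<subseteq> {1..n}"
  shows "anti (odd_sum n x A) (parity n A)"
proof -
  have "parity n A * odd_sum n x A = (\<Sum>i\<in>A. - (odd_at n x i * parity n A))"
    unfolding odd_sum_def sum_distrib_left
    by (rule sum.cong) (use parity_odd_at[OF x] A in auto)
  then show ?thesis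
    by (simp add: anti_def odd_sum_def sum_distrib_right sum_negf)
qed

lemma parity_odd_sum_other:
  assumes x: "U_gen gen_P * x = - (x * U_gen gen_P)" and AB: "A \<subseteq> {1..n}" "A \<inter> B = {}"
  shows "parity n B * odd_sum n x A = odd_sum n x A * parity n B"
proof -
  have "parity n B * odd_at n x i = odd_at n x i * parity n B" if "i \<in> A" for i
    using that AB by (subst parity_odd_at[OF x]) auto
  then show ?thesis
    unfolding odd_sum_def sum_distrib_left sum_distrib_right by (rule sum.cong[OF refl])
qed

lemma scaleC_anticommute:
  "U_gen gen_P * x = - (x * U_gen gen_P) \<Longrightarrow> U_gen gen_P * (c *\<^sub>C x) = - ((c *\<^sub>C x) * U_gen gen_P)"
  by (simp add: mult_scaleC_left mult_scaleC_right)

lemma scaleC_two: "2 *\<^sub>C x = x + x" for x :: "'a::complex_vector"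
  using scaleC_add_left[of 1 1 x] by (simp add: scaleC_one)

text \<open>The squares of \<open>F\<^sup>+\<close> and \<open>F\<^sup>-\<close> are
  \<open>E\<^sup>+ / 4\<close> and \<open>- E\<^sup>- / 4\<close>, and bracketing with the opposite
  \<open>F\<close> gives back a multiple of \<open>F\<close>. The factor 8 produces the constants of
  \<open>cubic\<close>: 64 * (-1/4) = -2 * 8 and 8 * (1/4) = 2.\<close>

lemma cubic_odd_at:
  assumes i: "1 \<le> i" "i \<le> n"
  shows "cubic (odd_at n (8 *\<^sub>C U_gen gen_Fp) i) (odd_at n (U_gen gen_Fm) i)"
proof -
  let ?Fp = "U_gen gen_Fp" and ?Fm = "U_gen gen_Fm"
  note lin = odd_at_linear[OF i]
  have diff: "odd_at n (a - b) i = odd_at n a i - odd_at n b i" for a b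
    using lin(1)[of "a - b" b] by simp
  have "?Fp * ?Fp * ?Fm - ?Fm * ?Fp * ?Fp = (1/4) *\<^sub>C (- ?Fp)"
    by (simp add: mult.assoc[of ?Fm] U_relations mult_scaleC_left mult_scaleC_right scaleC_add_right cvs.scale_right_diff_distrib)
  then have "64 *\<^sub>C (?Fp * ?Fp * ?Fm - ?Fm * ?Fp * ?Fp) = - (2 *\<^sub>C (8 *\<^sub>C ?Fp))"
    by (simp add: scaleC_scaleC)
  then have 1: "(8 *\<^sub>C ?Fp) * (8 *\<^sub>C ?Fp) * ?Fm - ?Fm * (8 *\<^sub>C ?Fp) * (8 *\<^sub>C ?Fp) = - (2 *\<^sub>C (8 *\<^sub>C ?Fp))"
    by (simp add: mult_scaleC_left mult_scaleC_right scaleC_scaleC cvs.scale_right_diff_distrib)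
  have "?Fm * ?Fm * ?Fp - ?Fp * (?Fm * ?Fm) = (1/4) *\<^sub>C ?Fm"
    by (simp add: U_relations mult_scaleC_left mult_scaleC_right scaleC_add_right cvs.scale_right_diff_distrib)
  then have "8 *\<^sub>C (?Fm * ?Fm * ?Fp - ?Fp * ?Fm * ?Fm) = 2 *\<^sub>C ?Fm"
    by (simp add: mult.assoc[of ?Fp] scaleC_scaleC)
  then have 2: "?Fm * ?Fm * (8 *\<^sub>C ?Fp) - (8 *\<^sub>C ?Fp) * ?Fm * ?Fm = 2 *\<^sub>C ?Fm"
    by (simp add: mult_scaleC_left mult_scaleC_right scaleC_scaleC cvs.scale_right_diff_distrib)
  show ?thesis
    unfolding cubic_def odd_at_mult3 diff[symmetric] 1 2 by (simp only: lin scaleC_two)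
qed

text \<open>Each further place contributes a copy that anticommutes with the previous ones, so
  \<open>cubic_add\<close> applies.\<close>

lemma cubic_odd_sum:
  assumes "A \<subseteq> {1..n}"
  shows "cubic (odd_sum n (8 *\<^sub>C U_gen gen_Fp) A) (odd_sum n (U_gen gen_Fm) A)"
proof -
  have "finite A" using assms finite_subset by blast
  then show ?thesis
    using assms
  proof (induction A rule: finite_induct)
    case empty
    show ?case by (simp add: odd_sum_def cubic_def)
  next
    case (insert i A)
    have u: "odd_sum n x (insert i A) = odd_sum n x {i} + odd_sum n x A" for x
      using insert by (simp add: odd_sum_def)
    have "cubic (odd_sum n (8 *\<^sub>C U_gen gen_Fp) {i}) (odd_sum n (U_gen gen_Fm) {i})"
      using cubic_odd_at insert.prems by (simp add: odd_sum_def)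
    then show ?case
      unfolding u
      by (rule cubic_add) (use insert in \<open>auto intro!: odd_sum_anticommute scaleC_anticommute P_F_anticommute\<close>)
  qed
qed

lemma super_casimir_casimir_of:
  assumes "A \<subseteq> {1..n}"
  shows "super_casimir n A = casimir_of (odd_sum n (8 *\<^sub>C U_gen gen_Fp) A) (odd_sum n (U_gen gen_Fm) A) (parity n A)"
proof -
  have "odd_sum n (8 *\<^sub>C U_gen gen_Fp) A = 8 *\<^sub>C odd_sum n (U_gen gen_Fp) A"
    unfolding odd_sum_def cvs.scale_sum_right
    by (rule sum.cong) (use assms odd_at_linear(2) in auto)
  then show ?thesis
    by (simp add: super_casimir_def casimir_of_def mult_scaleC_left mult_scaleC_right left_diff_distrib
        cvs.scale_right_diff_distrib)
qed

lemma three_copies_disjoint_family: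
  assumes sub: "\<And>i. S i \<subseteq> {1..n}" and disj: "\<And>i j. i \<noteq> j \<Longrightarrow> S i \<inter> S j = {}"
  shows "three_copies (\<lambda>i. odd_sum n (8 *\<^sub>C U_gen gen_Fp) (S i)) (\<lambda>i. odd_sum n (U_gen gen_Fm) (S i))
    (\<lambda>i. parity n (S i)) (tens_one n)"
proof -
  have x: "U_gen gen_P * (8 *\<^sub>C U_gen gen_Fp) = - ((8 *\<^sub>C U_gen gen_Fp) * U_gen gen_P)"
    and y: "U_gen gen_P * U_gen gen_Fm = - (U_gen gen_Fm * U_gen gen_P)"
    by (simp_all add: scaleC_anticommute P_F_anticommute)
  show ?thesis
  proof
    fix i j :: nat
    show "parity n (S i) * parity n (S i) = tens_one n"
      by (simp add: parity_mult parity_empty)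
    show "parity n (S i) * parity n (S j) = parity n (S j) * parity n (S i)"
      by (simp add: parity_mult Un_commute)
    assume "i \<noteq> j"
    then have "S i \<inter> S j = {}" "S j \<inter> S i = {}" using disj by auto
    then show "parity n (S i) * odd_sum n (8 *\<^sub>C U_gen gen_Fp) (S j) = odd_sum n (8 *\<^sub>C U_gen gen_Fp) (S j) * parity n (S i)"
      "parity n (S i) * odd_sum n (U_gen gen_Fm) (S j) = odd_sum n (U_gen gen_Fm) (S j) * parity n (S i)"
      "anti (odd_sum n (8 *\<^sub>C U_gen gen_Fp) (S i)) (odd_sum n (8 *\<^sub>C U_gen gen_Fp) (S j))"
      "anti (odd_sum n (8 *\<^sub>C U_gen gen_Fp) (S i)) (odd_sum n (U_gen gen_Fm) (S j))"
      "anti (odd_sum n (U_gen gen_Fm) (S i)) (odd_sum n (U_gen gen_Fm) (S j))"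
      using sub by (simp_all add: parity_odd_sum_other x y odd_sum_anticommute)
  qed (simp_all only: cubic_odd_sum[OF sub] tens_one_left tens_one_right odd_sum_in_tens_deg parity_in_tens_deg
      parity_odd_sum_own[OF x sub] parity_odd_sum_own[OF y sub])
qed

lemma super_casimir_bannai_ito:
  assumes A: "A \<subseteq> {1..n}" and B: "B \<subseteq> {1..n}"
  shows "super_casimir n A * super_casimir n B + super_casimir n B * super_casimir n A =
    2 *\<^sub>C (- super_casimir n ((A \<union> B) - (A \<inter> B))
       + super_casimir n (A - (A \<inter> B)) * super_casimir n (B - (A \<inter> B))
       + super_casimir n (A \<inter> B) * super_casimir n (A \<union> B))"
proof -
  \<comment> \<open>The overlap gets the middle index 1. All indices from 3 on, and any empty
    difference or intersection, give the trivial copy with \<open>x = y = 0\<close> and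
    \<open>p = e\<close>.\<close>
  define S :: "nat \<Rightarrow> nat set" where
    "S i = (if i = 0 then A - B else if i = 1 then A \<inter> B else if i = 2 then B - A else {})" for i
  have sub: "S i \<subseteq> {1..n}" for i using A B by (auto simp: S_def)
  have disj: "S i \<inter> S j = {}" if "i \<noteq> j" for i j using that by (auto simp: S_def)
  interpret three_copies "\<lambda>i. odd_sum n (8 *\<^sub>C U_gen gen_Fp) (S i)" "\<lambda>i. odd_sum n (U_gen gen_Fm) (S i)"
    "\<lambda>i. parity n (S i)" "tens_one n"
    by (rule three_copies_disjoint_family[OF sub disj])
  have c1: "c i = super_casimir n (S i)" for i
    by (simp add: c_def super_casimir_casimir_of[OF sub])
  have c2: "c2 i j = super_casimir n (S i \<union> S j)" if "i \<noteq> j" for i j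
    using disj[OF that] sub[of i] sub[of j]
    by (simp add: c2_def super_casimir_casimir_of odd_sum_union parity_union)
  have c3: "c3 i j k = super_casimir n (S i \<union> S j \<union> S k)" if "i \<noteq> j" "j \<noteq> k" "i \<noteq> k" for i j k
  proof -
    have "(S i \<union> S j) \<inter> S k = {}" using disj that by blast
    then show ?thesis
      using disj[OF that(1)] sub[of i] sub[of j] sub[of k]
      by (simp add: c3_def super_casimir_casimir_of odd_sum_union parity_union)
  qed
  have "S 0 \<union> S 1 = A" "S 1 \<union> S 2 = B" "S 0 \<union> S 2 = (A \<union> B) - (A \<inter> B)" "S 0 = A - (A \<inter> B)"
    "S 2 = B - (A \<inter> B)" "S 1 = A \<inter> B" "S 0 \<union> S 1 \<union> S 2 = A \<union> B"
    by (auto simp: S_def)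
  then show ?thesis
    using bannai_ito[of 0 1 2] by (simp add: c1 c2 c3 scaleC_two)
qed

section \<open>The homomorphism out of \<open>BI n\<close>\<close>

lemma BI_relations_closed: "BI_relations n \<subseteq> carrier (free_algebra (Pow {1..n}))"
  unfolding BI_relations_def
  by (auto intro!: free_algebra_closed free_algebra_scaleC_closed free_gen_closed)

lemma super_casimir_in_tens_deg: "super_casimir n A \<in> tens_deg n"
  unfolding super_casimir_def
  by (intro cvs.span_add cvs.span_scale cvs.span_diff tens_deg_mult odd_sum_in_tens_deg parity_in_tens_deg)

lemma BI_relations_super_casimir:
  assumes "r \<in> BI_relations n"
  shows "free_eval (tens_one n) (super_casimir n) r = 0"
proof -
  let ?ev = "free_eval (tens_one n) (super_casimir n)"
  \<comment> \<open>\<open>super_casimir n A\<close> has degree \<open>n\<close> for every set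
    \<open>A\<close>, so the evaluation is multiplicative on the entire free algebra.\<close>
  have mult: "?ev (f * g) = ?ev f * ?ev g" for f g
    by (rule tens.free_eval_mult[of _ UNIV]) (auto simp: super_casimir_in_tens_deg free_algebra_def)
  have gen: "?ev (free_gen A) = super_casimir n A" for A
    by (rule tens.free_eval_free_gen) (rule super_casimir_in_tens_deg)
  consider "r = free_gen {} - 1" | A B where "A \<subseteq> {1..n}" "B \<subseteq> {1..n}"
    "r = free_gen A * free_gen B + free_gen B * free_gen A
        - 2 *\<^sub>C (- free_gen ((A \<union> B) - (A \<inter> B))
               + free_gen (A - (A \<inter> B)) * free_gen (B - (A \<inter> B))
               + free_gen (A \<inter> B) * free_gen (A \<union> B))"
    using assms unfolding BI_relations_def by blast
  then show ?thesis
  proof cases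
    case 1
    then show ?thesis by (simp add: free_eval_linear gen tens.free_eval_one super_casimir_empty)
  next
    case 2
    show ?thesis
      unfolding 2(3) free_eval_linear mult gen super_casimir_bannai_ito[OF 2(1,2)] by simp
  qed
qed

text \<open>A homomorphism on \<open>BI n\<close> is fixed by the generators only inside the
  carrier; restricting it yields the extensional representative, which is unique as a
  function.\<close>

lemma alg_hom_restrict:
  assumes A: "ring A" and h: "h \<in> alg_hom A B"
    and smult: "\<And>c x. x \<in> carrier A \<Longrightarrow> c \<odot>\<^bsub>A\<^esub> x \<in> carrier A"
  shows "restrict h (carrier A) \<in> alg_hom A B"
proof -
  interpret ring A by (rule A)
  show ?thesis
    using h by (auto simp: alg_hom_def ring_hom_def smult)
qed

theorem proposition4p1:
  fixes n :: nat
  assumes "n \<ge> 1"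
  shows "\<exists>!\<phi>. \<phi> \<in> alg_hom (BI n) (tensor_power n) \<and> \<phi> \<in> extensional (carrier (BI n)) \<and>
           (\<forall>A. A \<subseteq> {1..n} \<longrightarrow> \<phi> (BI_gen n A) = intermediate_casimir n A)"
proof (rule ex_ex1I)
  let ?G = "Pow {1..n}"
  let ?p = "presented_class ?G (BI_relations n)"
  have "\<exists>h \<in> alg_hom (BI n) (tensor_power n). \<forall>f\<in>carrier (free_algebra ?G).
      h (?p f) = free_eval (tens_one n) (super_casimir n) f"
    unfolding BI_def tensor_power_alg_on
    by (rule tens.presented_algebra_hom_exists[OF BI_relations_closed _ BI_relations_super_casimir])
      (use super_casimir_in_tens_deg in auto)
  then obtain h where h: "h \<in> alg_hom (BI n) (tensor_power n)"
    and eq: "\<And>f. f \<in> carrier (free_algebra ?G) \<Longrightarrow> h (?p f) = free_eval (tens_one n) (super_casimir n) f"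
    by blast
  have gen_closed: "BI_gen n A \<in> carrier (BI n)" if "A \<subseteq> {1..n}" for A
    using that free_gen_closed[of A ?G] by (simp add: BI_gen_def BI_def carrier_presented)
  have gen: "h (BI_gen n A) = intermediate_casimir n A" if "A \<subseteq> {1..n}" for A
    using that eq[OF free_gen_closed[of A ?G]]
    by (simp add: BI_gen_def tens.free_eval_free_gen super_casimir_in_tens_deg
        intermediate_casimir_super_casimir)
  have smult: "c \<odot>\<^bsub>BI n\<^esub> x \<in> carrier (BI n)" if "x \<in> carrier (BI n)" for c x
  proof -
    obtain f where f: "f \<in> carrier (free_algebra ?G)" "x = ?p f"
      using \<open>x \<in> carrier (BI n)\<close> unfolding BI_def carrier_presented by blast
    show ?thesis
      unfolding BI_def f(2) presented_class_smult[OF BI_relations_closed f(1)] carrier_presented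
      by (rule imageI) (rule free_algebra_scaleC_closed[OF f(1)])
  qed
  have "restrict h (carrier (BI n)) \<in> alg_hom (BI n) (tensor_power n)"
    by (rule alg_hom_restrict[OF ring_presented[OF BI_relations_closed, folded BI_def] h smult])
  then show "\<exists>\<phi>. \<phi> \<in> alg_hom (BI n) (tensor_power n) \<and> \<phi> \<in> extensional (carrier (BI n)) \<and>
      (\<forall>A. A \<subseteq> {1..n} \<longrightarrow> \<phi> (BI_gen n A) = intermediate_casimir n A)"
    by (intro exI[of _ "restrict h (carrier (BI n))"]) (simp add: gen gen_closed)
next
  fix \<phi> \<psi>
  assume \<phi>: "\<phi> \<in> alg_hom (BI n) (tensor_power n) \<and> \<phi> \<in> extensional (carrier (BI n)) \<and>
      (\<forall>A. A \<subseteq> {1..n} \<longrightarrow> \<phi> (BI_gen n A) = intermediate_casimir n A)"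
    and \<psi>: "\<psi> \<in> alg_hom (BI n) (tensor_power n) \<and> \<psi> \<in> extensional (carrier (BI n)) \<and>
      (\<forall>A. A \<subseteq> {1..n} \<longrightarrow> \<psi> (BI_gen n A) = intermediate_casimir n A)"
  have "\<phi> x = \<psi> x" if "x \<in> carrier (BI n)" for x
    by (rule tens.presented_algebra_hom_unique[OF BI_relations_closed])
      (use \<phi> \<psi> that in \<open>auto simp: BI_def BI_gen_def tensor_power_alg_on\<close>)
  then show "\<phi> = \<psi>"
    using \<phi> \<psi> by (intro extensionalityI[of \<phi> "carrier (BI n)"]) auto
qed

end
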